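(* Let $\mathbf{P}$ be a fixed $a\times b$ matrix of rank $r$ with non-negative entries and with no identically zero row or column, let $\mathbf{B}$ be its $m\times n$ blown up matrix, $\mathbf{W}$ an $m\times n$ Wigner-noise, and $\mathbf{A}=\mathbf{B}+\mathbf{W}$. Under the growth conditions GC1 and GC2, there exists a positive number $\delta$ (independent of $m$ and $n$) such that for every $0<\tau<1/2$ the following statement holds almost surely: the $r$ largest singular values of $\mathbf{A}_{corr}$ are in the interval $$\left[\delta-\max\{n^{-\tau},m^{-\tau}\},\ 1+\max\{n^{-\tau},m^{-\tau}\}\right],$$ while all the others are at most $\max\{n^{-\tau},m^{-\tau}\}$.
   Context: Wigner-noise: an $m\times n$ real random matrix $\mathbf{W}$ with independent entries $w_{ij}$, $\mathbb{E}(w_{ij})=0$, uniformly bounded: $|w_{ij}|\le K$ for all $i,j$, with a constant $K>0$ independent of $m$ and $n$. Blown up matrix: given the $a\times b$ pattern matrix $\mathbf{P}=(p_{ij})$ and positive integers $m_1,\dots,m_a$ with $\sum_i m_i=m$ and $n_1,\dots,n_b$ with $\sum_j n_j=n$, the blown up matrix $\mathbf{B}$ is the $m\times n$ matrix divided into $a\times b$ blocks, where block $(i,j)$ is an $m_i\times n_j$ matrix with all entries equal to $p_{ij}$. The pattern $\mathbf{P}$ is fixed, while $m,n$ and the block sizes vary. GC1: there are constants $0<c<1$ and $0<d<1$, independent of $m,n$, such that $m_i/m\ge c$ for $i=1,\dots,a$ and $n_j/n\ge d$ for $j=1,\dots,b$. GC2: there are constants $C\ge1$, $D\ge1$, $C_0>0$,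 $D_0>0$ such that $m\le C_0 n^C$ and $n\le D_0 m^D$ hold for sufficiently large $m$ and $n$. Correspondence transformation: for $\mathbf{A}=(a_{ij})$ put $\mathbf{D}_{Arow}=\mathrm{diag}(\sum_j a_{1j},\dots,\sum_j a_{mj})$, $\mathbf{D}_{Acol}=\mathrm{diag}(\sum_i a_{i1},\dots,\sum_i a_{in})$ and $\mathbf{A}_{corr}=\mathbf{D}_{Arow}^{-1/2}\mathbf{A}\mathbf{D}_{Acol}^{-1/2}$ (part of the almost sure claim being that, for $m,n$ large, the row and column sums are positive so that this is defined). Almost surely: a property $\mathcal{P}_{m,n}$ holds almost surely for the random matrices $\mathbf{A}_{m\times n}$ if $\mathbb{P}(\exists\, m_0,n_0\in\mathbb{N}$ such that for all $m\ge m_0$ and $n\ge n_0$, $\mathbf{A}_{m\times n}$ has $\mathcal{P}_{m,n})=1$, where $m,n$ and the block sizes grow subject to the stated growth conditions and $K$ is kept fixed. *)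

theory Defs
  imports
    "HOL-Probability.Probability"
    "Jordan_Normal_Form.Char_Poly"
    "Jordan_Normal_Form.DL_Rank"
begin

text \<open>Singular values, in non-increasing order and with multiplicity: the square roots of the
  \<open>min m n\<close> largest eigenvalues of the Gram matrix of the \<open>m\<close>-by-\<open>n\<close> matrix \<open>A\<close>. The matrix
  \<open>A\<^sup>T * A\<close> is symmetric and positive semidefinite, so its characteristic polynomial has
  \<open>n\<close> real non-negative roots, and those cut off by \<open>take\<close> are zero.\<close>

definition singular_values :: "real mat \<Rightarrow> real list" where
  "singular_values A =
     take (min (dim_row A) (dim_col A))
       (rev (map sqrt (sorted_list_of_multiset (proots (char_poly (transpose_mat A * A))))))"

definition row_sum :: "real mat \<Rightarrow> nat \<Rightarrow> real" where
  "row_sum A i = (\<Sum>j<dim_col A. A $$ (i, j))"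

definition col_sum :: "real mat \<Rightarrow> nat \<Rightarrow> real" where
  "col_sum A j = (\<Sum>i<dim_row A. A $$ (i, j))"

text \<open>The value is meaningful only if all row and column sums are positive.\<close>

definition corr :: "real mat \<Rightarrow> real mat" where
  "corr A =
     mat_diag (dim_row A) (\<lambda>i. row_sum A i powr (- 1/2)) * A *
     mat_diag (dim_col A) (\<lambda>j. col_sum A j powr (- 1/2))"

text \<open>\<open>block_labels [m\<^sub>0, m\<^sub>1, \<dots>] = [0, \<dots>, 0, 1, \<dots>, 1, \<dots>]\<close>, with \<open>k\<close> occurring \<open>m\<^sub>k\<close> times:
  the \<open>i\<close>-th entry is the block that contains row (or column) \<open>i\<close>.\<close>

definition block_labels :: "nat list \<Rightarrow> nat list" where
  "block_labels ms = concat (map (\<lambda>k. replicate (ms ! k) k) [0..<length ms])"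

definition blown_up :: "real mat \<Rightarrow> nat list \<Rightarrow> nat list \<Rightarrow> real mat" where
  "blown_up P ms ns =
     Matrix.mat (sum_list ms) (sum_list ns)
       (\<lambda>(i, j). P $$ (block_labels ms ! i, block_labels ns ! j))"

definition block_sizes :: "nat \<Rightarrow> nat \<Rightarrow> nat list \<Rightarrow> bool" where
  "block_sizes a m ms \<longleftrightarrow> length ms = a \<and> (\<forall>x\<in>set ms. 0 < x) \<and> sum_list ms = m"

definition wigner_noise :: "'w measure \<Rightarrow> real \<Rightarrow> nat \<Rightarrow> nat \<Rightarrow> ('w \<Rightarrow> real mat) \<Rightarrow> bool" where
  "wigner_noise M K m n W \<longleftrightarrow>
     (\<forall>\<omega>\<in>space M. W \<omega> \<in> carrier_mat m n) \<and>
     prob_space.indep_vars M (\<lambda>_. borel) (\<lambda>(i, j) \<omega>. W \<omega> $$ (i, j)) ({..<m} \<times> {..<n}) \<and>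
     (\<forall>i<m. \<forall>j<n. prob_space.expectation M (\<lambda>\<omega>. W \<omega> $$ (i, j)) = 0 \<and>
        (AE \<omega> in M. \<bar>W \<omega> $$ (i, j)\<bar> \<le> K))"

definition GC1 :: "real \<Rightarrow> real \<Rightarrow> nat list \<Rightarrow> nat list \<Rightarrow> bool" where
  "GC1 c d ms ns \<longleftrightarrow>
     (\<forall>x\<in>set ms. real x / real (sum_list ms) \<ge> c) \<and>
     (\<forall>y\<in>set ns. real y / real (sum_list ns) \<ge> d)"

text \<open>The growth condition for one pair of sizes; it is imposed on the pairs
  with \<open>m \<ge> m0\<close> and \<open>n \<ge> n0\<close> that the almost sure statement ranges over.\<close>

definition GC2 :: "real \<Rightarrow> real \<Rightarrow> real \<Rightarrow> real \<Rightarrow> nat \<Rightarrow> nat \<Rightarrow> bool" where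
  "GC2 C C0 D D0 m n \<longleftrightarrow>
     real m \<le> C0 * real n powr C \<and> real n \<le> D0 * real m powr D"

end

theory Submission
  imports Defs "HOL-Real_Asymp.Real_Asymp"
begin

text \<open>Write \<open>A\<^sub>c\<^sub>o\<^sub>r\<^sub>r = U B V + U W V\<close> with \<open>U\<close>, \<open>V\<close> the diagonal scalings by the row and column sums of
  \<open>A\<close>, and let \<open>\<mu> = min m n\<close>. Hoeffding's inequality, applied to the row and column sums of \<open>W\<close> and
  to \<open>y\<^sup>T W x\<close> for all \<open>x\<close>, \<open>y\<close> in a fine grid of the unit balls, shows with the Borel--Cantelli
  lemma (GC2 makes the number of pairs with the same \<open>\<mu>\<close> polynomial in \<open>\<mu>\<close>) that eventually the sums
  deviate from those of \<open>B\<close> by a relative error of order \<open>\<mu>\<close> to the power \<open>\<eta> - 1/2\<close>, and that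
  \<open>\<parallel>W\<parallel> \<le> \<surd>(m + n) \<mu>\<^sup>\<eta> + 2 K\<close>. Hence \<open>\<parallel>U W V\<parallel> = o(\<epsilon>)\<close>, and \<open>\<parallel>U B V\<parallel> \<le> 1 + \<epsilon> / 2\<close> by AM-GM and the row and
  column sums of \<open>B\<close>.

  A rank factorization of the pattern shows that \<open>U B V\<close> vanishes on a subspace of codimension \<open>r\<close>
  and expands an \<open>r\<close>-dimensional subspace by at least \<open>\<delta> > 0\<close>, uniformly in \<open>m\<close> and \<open>n\<close> by GC1. By the
  spectral theorem for \<open>A\<^sup>T A\<close> and a dimension count, this controls the singular values with index
  at least \<open>r\<close> and below \<open>r\<close>, respectively.\<close>

section \<open>Singular values of real matrices\<close>

text \<open>Padding the system with zero rows to a square matrix makes it singular. This is the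
  dimension count behind both minimax bounds.\<close>

lemma exists_nonzero_solution:
  fixes F :: "nat \<Rightarrow> nat \<Rightarrow> real"
  assumes "k < l"
  shows "\<exists>x. (\<exists>j<l. x j \<noteq> 0) \<and> (\<forall>i<k. (\<Sum>j<l. F i j * x j) = 0)"
proof -
  define A where "A = Matrix.mat l l (\<lambda>(i, j). if i < k then F i j else 0)"
  have A: "A \<in> carrier_mat l l" by (simp add: A_def)
  \<comment> \<open>Row \<open>k\<close> of \<open>A\<close> is a padding row, so the transpose
    annihilates the \<open>k\<close>-th unit vector.\<close>
  have "transpose_mat A *\<^sub>v unit_vec l k = 0\<^sub>v l"
    using assms by (auto simp: A_def mult_mat_vec_def intro!: eq_vecI)
  moreover have "unit_vec l k \<noteq> (0\<^sub>v l :: real Matrix.vec)"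
    using assms by (metis index_unit_vec(2) index_zero_vec(1) zero_neq_one)
  ultimately have "Determinant.det (transpose_mat A) = 0"
    using A by (subst det_0_iff_vec_prod_zero[of _ l]) (auto intro!: exI[of _ "unit_vec l k"])
  hence "Determinant.det A = 0"
    using det_transpose[OF A] by simp
  then obtain v where v: "v \<in> carrier_vec l" "v \<noteq> 0\<^sub>v l" "A *\<^sub>v v = 0\<^sub>v l"
    using det_0_iff_vec_prod_zero[OF A] by blast
  have "\<exists>j<l. vec_index v j \<noteq> 0"
    using v(1,2) by (metis carrier_vecD eq_vecI index_zero_vec(1) index_zero_vec(2))
  moreover have "(\<Sum>j<l. F i j * vec_index v j) = 0" if "i < k" for i
  proof -
    have "vec_index (A *\<^sub>v v) i = 0" using v(3) that assms by simp
    thus ?thesis using that assms v(1)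
      by (simp add: A_def scalar_prod_def atLeast0LessThan)
  qed
  ultimately show ?thesis by blast
qed

section \<open>The spectral theorem for real symmetric matrices\<close>

text \<open>The fundamental theorem of algebra supplies a complex eigenpair. Symmetry forces the
  eigenvalue to be real, and then the real or the imaginary part of the eigenvector is a real
  eigenvector.\<close>

lemma symmetric_has_eigenvector:
  fixes G :: "nat \<Rightarrow> nat \<Rightarrow> real"
  assumes n: "n > 0" and sym: "\<And>i j. i < n \<Longrightarrow> j < n \<Longrightarrow> G i j = G j i"
  shows "\<exists>e v. (\<Sum>i<n. (v i)\<^sup>2) = 1 \<and> (\<forall>i<n. (\<Sum>j<n. G i j * v j) = e * v i)"
proof -
  define A where "A = Matrix.mat n n (\<lambda>(i, j). complex_of_real (G i j))"
  have A: "A \<in> carrier_mat n n" by (simp add: A_def)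
  have "degree (char_poly A) = n" using degree_monic_char_poly[OF A] by simp
  hence "\<not> constant (poly (char_poly A))" using n by (simp add: constant_degree)
  then obtain z where "poly (char_poly A) z = 0" using fundamental_theorem_of_algebra by blast
  hence "eigenvalue A z" using eigenvalue_root_char_poly[OF A] by simp
  then obtain v where v: "v \<in> carrier_vec n" "v \<noteq> 0\<^sub>v n" "A *\<^sub>v v = z \<cdot>\<^sub>v v"
    using A unfolding eigenvalue_def eigenvector_def by auto
  have ev: "(\<Sum>j<n. complex_of_real (G i j) * vec_index v j) = z * vec_index v i" if "i < n" for i
  proof -
    have "vec_index (A *\<^sub>v v) i = z * vec_index v i" using v(3) that v(1) by simp
    thus ?thesis using that v(1)
      by (simp add: A_def scalar_prod_def atLeast0LessThan)
  qed
  define x where "x = (\<lambda>i. Re (vec_index v i))"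
  define y where "y = (\<lambda>i. Im (vec_index v i))"
  have evx: "(\<Sum>j<n. G i j * x j) = Re z * x i - Im z * y i" if "i < n" for i
    using arg_cong[OF ev[OF that], of Re] by (simp add: x_def y_def)
  have evy: "(\<Sum>j<n. G i j * y j) = Re z * y i + Im z * x i" if "i < n" for i
    using arg_cong[OF ev[OF that], of Im] by (simp add: x_def y_def)
  obtain i0 where i0: "i0 < n" "vec_index v i0 \<noteq> 0"
    using v(1,2) by (metis carrier_vecD eq_vecI index_zero_vec(1) index_zero_vec(2))
  \<comment> \<open>By symmetry \<open>y \<bullet> G x = x \<bullet> G y\<close>. Inserting the
    eigenvalue equations turns this into \<open>Im z * |v|\<^sup>2 = 0\<close>.\<close>
  have "(\<Sum>i<n. y i * (\<Sum>j<n. G i j * x j)) = (\<Sum>i<n. \<Sum>j<n. G i j * y i * x j)"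
    by (simp add: sum_distrib_left mult_ac)
  also have "\<dots> = (\<Sum>j<n. \<Sum>i<n. G i j * y i * x j)" by (rule sum.swap)
  also have "\<dots> = (\<Sum>j<n. x j * (\<Sum>i<n. G j i * y i))"
    by (simp add: sum_distrib_left mult_ac sym)
  finally have "(\<Sum>i<n. y i * (Re z * x i - Im z * y i)) = (\<Sum>i<n. x i * (Re z * y i + Im z * x i))"
    by (simp add: evx evy)
  hence "Im z * (\<Sum>i<n. (x i)\<^sup>2 + (y i)\<^sup>2) = 0"
    by (simp add: algebra_simps sum.distrib sum_subtractf sum_distrib_left power2_eq_square)
  moreover have "(\<Sum>i<n. (x i)\<^sup>2 + (y i)\<^sup>2) > 0"
  proof (rule sum_pos2[of _ i0])
    show "0 < (x i0)\<^sup>2 + (y i0)\<^sup>2" using i0 by (simp add: x_def y_def complex_eq_iff sum_power2_gt_zero_iff)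
  qed (use i0 in auto)
  ultimately have "Im z = 0" by simp
  have "\<exists>w. (\<exists>i<n. w i \<noteq> 0) \<and> (\<forall>i<n. (\<Sum>j<n. G i j * w j) = Re z * w i)"
  proof (cases "x i0 = 0")
    case True
    hence "y i0 \<noteq> 0" using i0 by (simp add: x_def y_def complex_eq_iff)
    thus ?thesis using evy \<open>Im z = 0\<close> i0 by (intro exI[of _ y]) auto
  next
    case False
    thus ?thesis using evx \<open>Im z = 0\<close> i0 by (intro exI[of _ x]) auto
  qed
  then obtain w i1 where w: "i1 < n" "w i1 \<noteq> 0" "\<And>i. i < n \<Longrightarrow> (\<Sum>j<n. G i j * w j) = Re z * w i"
    by blast
  define N where "N = (\<Sum>i<n. (w i)\<^sup>2)"
  have N: "N > 0" unfolding N_def by (rule sum_pos2[of _ i1]) (use w in auto)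
  show ?thesis
  proof (intro exI[of _ "Re z"] exI[of _ "\<lambda>i. w i / sqrt N"] conjI allI impI)
    show "(\<Sum>i<n. (w i / sqrt N)\<^sup>2) = 1"
      using N by (simp add: power_divide sum_divide_distrib[symmetric]) (simp add: N_def)
  next
    fix i assume "i < n"
    thus "(\<Sum>j<n. G i j * (w j / sqrt N)) = Re z * (w i / sqrt N)"
      using w(3)[of i] by (simp add: sum_divide_distrib[symmetric])
  qed
qed

text \<open>A reflection exchanges the unit vector \<open>v\<close> with the first axis and is its
  own inverse and transpose, which spares completing \<open>v\<close> to an orthonormal basis. When
  \<open>v 0 = 1\<close> the reflecting vector vanishes, and the identity serves.\<close>

lemma householder:
  fixes v :: "nat \<Rightarrow> real"
  assumes n: "n > 0" and v: "(\<Sum>i<n. (v i)\<^sup>2) = 1"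
  shows "\<exists>H\<in>carrier_mat n n. transpose_mat H = H \<and> H * H = 1\<^sub>m n \<and> (\<forall>i<n. H $$ (i, 0) = v i)"
proof (cases "v 0 = 1")
  case True
  have "v i = 0" if "i < n" "i \<noteq> 0" for i
  proof -
    have "(\<Sum>i\<in>{..<n} - {0}. (v i)\<^sup>2) = 0"
      using v n True by (subst sum_diff1) auto
    hence "(v i)\<^sup>2 = 0" using that by (subst (asm) sum_nonneg_eq_0_iff) auto
    thus ?thesis by simp
  qed
  thus ?thesis using True n by (intro bexI[of _ "1\<^sub>m n"]) auto
next
  case False
  define u where "u = (\<lambda>i. (if i = 0 then 1 else 0) - v i)"
  have split: "(\<Sum>i<n. f i) = f 0 + (\<Sum>i\<in>{..<n} - {0}. f i)" for f :: "nat \<Rightarrow> real"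
    using n by (subst sum.remove[of _ 0]) auto
  have uu: "(\<Sum>i<n. u i * u i) = 2 * u 0"
  proof -
    have "(\<Sum>i\<in>{..<n} - {0}. u i * u i) = (\<Sum>i\<in>{..<n} - {0}. (v i)\<^sup>2)"
      by (rule sum.cong) (auto simp: u_def power2_eq_square)
    also have "\<dots> = 1 - (v 0)\<^sup>2" using v split[of "\<lambda>i. (v i)\<^sup>2"] by simp
    finally show ?thesis by (subst split) (simp add: u_def power2_eq_square algebra_simps)
  qed
  have u0: "u 0 \<noteq> 0" using False by (simp add: u_def)
  \<comment> \<open>The reflection \<open>1 - 2 u u\<^sup>T / |u|\<^sup>2\<close>, which swaps \<open>v\<close> and the first unit vector; here \<open>|u|\<^sup>2 = 2 u\<^sub>0\<close>.\<close>
  define H where "H = Matrix.mat n n (\<lambda>(i, j). (if i = j then 1 else 0) - u i * u j / u 0)"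
  have "(\<Sum>k<n. ((if i = k then 1 else 0) - u i * u k / u 0) * ((if k = j then 1 else 0) - u k * u j / u 0))
     = (if i = j then 1 else 0)" (is "?l = _") if ij: "i < n" "j < n" for i j
  proof -
    have "?l = (\<Sum>k<n. (if i = k then (if k = j then 1 else 0) else 0) - (if i = k then u k * u j / u 0 else 0)
        - (if k = j then u i * u k / u 0 else 0) + (u k * u k) * (u i * u j / (u 0)\<^sup>2))"
      by (intro sum.cong) (auto simp: algebra_simps power2_eq_square)
    also have "\<dots> = (if i = j then 1 else 0)"
      using ij u0 unfolding sum.distrib sum_subtractf sum_distrib_right[symmetric] uu
      by (auto simp: power2_eq_square)
    finally show ?thesis .
  qed
  hence "H * H = 1\<^sub>m n"
    by (intro eq_matI) (auto simp: H_def scalar_prod_def atLeast0LessThan)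
  moreover have "transpose_mat H = H" by (intro eq_matI) (auto simp: H_def)
  moreover have "H $$ (i, 0) = v i" if "i < n" for i
    using that n u0 by (auto simp: H_def u_def)
  ultimately show ?thesis by (intro bexI[of _ H]) (auto simp: H_def)
qed

text \<open>Deflation: conjugating with a Householder reflection whose first column is a unit
  eigenvector splits off a 1-by-1 block, and the induction hypothesis diagonalizes the remaining
  symmetric block.\<close>

lemma real_spectral_theorem:
  fixes G :: "real mat"
  assumes "G \<in> carrier_mat n n" "transpose_mat G = G"
  shows "\<exists>Q l. Q \<in> carrier_mat n n \<and> transpose_mat Q * Q = 1\<^sub>m n \<and> transpose_mat Q * G * Q = mat_diag n l"
  using assms
proof (induction n arbitrary: G)
  case 0
  hence "G = mat_diag 0 (\<lambda>_. 0)" by (intro eq_matI) (auto simp: mat_diag_def)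
  thus ?case by (intro exI[of _ "1\<^sub>m 0"] exI[of _ "\<lambda>_. 0"]) (auto simp: mat_diag_def)
next
  case (Suc n)
  note G = Suc.prems(1)
  have sym: "G $$ (i, j) = G $$ (j, i)" if "i < Suc n" "j < Suc n" for i j
    using that G arg_cong[OF Suc.prems(2), of "\<lambda>A. A $$ (i, j)"] by auto
  obtain e v where v: "(\<Sum>i<Suc n. (v i)\<^sup>2) = 1"
    and ev: "\<And>i. i < Suc n \<Longrightarrow> (\<Sum>j<Suc n. G $$ (i, j) * v j) = e * v i"
    using symmetric_has_eigenvector[of "Suc n" "\<lambda>i j. G $$ (i, j)"] sym by blast
  obtain H where H: "H \<in> carrier_mat (Suc n) (Suc n)" "transpose_mat H = H" "H * H = 1\<^sub>m (Suc n)"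
    and H0: "\<And>i. i < Suc n \<Longrightarrow> H $$ (i, 0) = v i"
    using householder[of "Suc n" v] v by blast
  define M where "M = H * (G * H)"
  have M: "M \<in> carrier_mat (Suc n) (Suc n)" using G H by (simp add: M_def)
  have "transpose_mat M = (transpose_mat H * transpose_mat G) * transpose_mat H"
    unfolding M_def using transpose_mult[OF H(1), of "G * H" "Suc n"] transpose_mult[OF G H(1)] G H(1)
    by (simp add: assoc_mult_mat[where n\<^sub>1="Suc n" and n\<^sub>2="Suc n" and n\<^sub>3="Suc n" and n\<^sub>4="Suc n"])
  also have "\<dots> = M" unfolding M_def H(2) Suc.prems(2) using G H(1)
    by (simp add: assoc_mult_mat[where n\<^sub>1="Suc n" and n\<^sub>2="Suc n" and n\<^sub>3="Suc n" and n\<^sub>4="Suc n"])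
  finally have tM: "transpose_mat M = M" .
  have symM: "M $$ (i, j) = M $$ (j, i)" if "i < Suc n" "j < Suc n" for i j
    using that M arg_cong[OF tM, of "\<lambda>A. A $$ (i, j)"] by auto
  have GH0: "(G * H) $$ (i, 0) = e * v i" if "i < Suc n" for i
    using that G H(1) H0 ev[OF that] by (simp add: scalar_prod_def atLeast0LessThan)
  \<comment> \<open>The first column of \<open>G * H\<close> is \<open>e * v\<close>. Since
    \<open>v\<close> is the first column of \<open>H\<close> and \<open>H * H = 1\<close>,
    multiplication by \<open>H\<close> sends it to \<open>e\<close> times the first unit
    vector.\<close>
  have M0: "M $$ (i, 0) = (if i = 0 then e else 0)" if "i < Suc n" for i
  proof -
    have "M $$ (i, 0) = (\<Sum>j<Suc n. H $$ (i, j) * (G * H) $$ (j, 0))"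
      using that G H(1) by (simp add: M_def scalar_prod_def atLeast0LessThan)
    also have "\<dots> = (\<Sum>j<Suc n. e * (H $$ (i, j) * H $$ (j, 0)))"
      by (intro sum.cong) (auto simp: GH0 H0)
    also have "\<dots> = e * (H * H) $$ (i, 0)"
      using that H(1) by (simp add: scalar_prod_def atLeast0LessThan sum_distrib_left distrib_left)
    finally show ?thesis using that by (simp add: H(3))
  qed
  define G' where "G' = Matrix.mat n n (\<lambda>(i, j). M $$ (Suc i, Suc j))"
  have G': "G' \<in> carrier_mat n n" by (simp add: G'_def)
  have "transpose_mat G' = G'" by (intro eq_matI) (auto simp: G'_def symM)
  then obtain Q' l' where Q': "Q' \<in> carrier_mat n n" "transpose_mat Q' * Q' = 1\<^sub>m n"
    "transpose_mat Q' * G' * Q' = mat_diag n l'"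
    using Suc.IH[OF G'] by blast
  define L where "L = mat_diag (Suc 0) (\<lambda>_. e)"
  have L: "L \<in> carrier_mat (Suc 0) (Suc 0)" by (simp add: L_def)
  have M_block: "M = four_block_mat L (0\<^sub>m (Suc 0) n) (0\<^sub>m n (Suc 0)) G'"
  proof (rule eq_matI)
    fix i j assume "i < dim_row (four_block_mat L (0\<^sub>m (Suc 0) n) (0\<^sub>m n (Suc 0)) G')"
      "j < dim_col (four_block_mat L (0\<^sub>m (Suc 0) n) (0\<^sub>m n (Suc 0)) G')"
    hence ij: "i < Suc n" "j < Suc n" using L G' by auto
    show "M $$ (i, j) = four_block_mat L (0\<^sub>m (Suc 0) n) (0\<^sub>m n (Suc 0)) G' $$ (i, j)"
      using ij M0[of i] M0[of j] symM[of 0 j]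
      by (cases i; cases j) (auto simp: L_def mat_diag_def G'_def)
  qed (use M L G' in auto)
  \<comment> \<open>\<open>K\<close> extends \<open>Q'\<close> by a 1 in the corner and so leaves
    the eigenvalue \<open>e\<close> alone; \<open>H * K\<close> is the orthogonal matrix
    sought.\<close>
  define K where "K = four_block_mat (1\<^sub>m (Suc 0)) (0\<^sub>m (Suc 0) n) (0\<^sub>m n (Suc 0)) Q'"
  have K: "K \<in> carrier_mat (Suc n) (Suc n)"
    unfolding K_def using four_block_carrier_mat[of "1\<^sub>m (Suc 0)" "Suc 0" "Suc 0" Q' n n] Q'(1) by simp
  have tK: "transpose_mat K = four_block_mat (1\<^sub>m (Suc 0)) (0\<^sub>m (Suc 0) n) (0\<^sub>m n (Suc 0)) (transpose_mat Q')"
    unfolding K_def using Q'(1) by (subst transpose_four_block_mat) auto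
  have KK: "transpose_mat K * K = 1\<^sub>m (Suc n)"
    unfolding tK unfolding K_def using Q'
    by (subst mult_four_block_mat[where ?nr1.0="Suc 0" and ?n1.0="Suc 0" and ?n2.0=n and ?nr2.0=n and ?nc1.0="Suc 0" and ?nc2.0=n])
      (auto simp: four_block_one_mat[of "Suc 0" n, simplified])
  have "transpose_mat K * M = four_block_mat L (0\<^sub>m (Suc 0) n) (0\<^sub>m n (Suc 0)) (transpose_mat Q' * G')"
    unfolding tK M_block using Q' L G'
    by (subst mult_four_block_mat[where ?nr1.0="Suc 0" and ?n1.0="Suc 0" and ?n2.0=n and ?nr2.0=n and ?nc1.0="Suc 0" and ?nc2.0=n]) auto
  hence "transpose_mat K * M * K = four_block_mat L (0\<^sub>m (Suc 0) n) (0\<^sub>m n (Suc 0)) (transpose_mat Q' * G' * Q')"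
    unfolding K_def using Q' L G'
    by simp (subst mult_four_block_mat[where ?nr1.0="Suc 0" and ?n1.0="Suc 0" and ?n2.0=n and ?nr2.0=n and ?nc1.0="Suc 0" and ?nc2.0=n], auto)
  also have "\<dots> = mat_diag (Suc n) (case_nat e l')"
    unfolding Q'(3) L_def
    by (rule eq_matI) (auto simp: mat_diag_def split: nat.splits)
  finally have KMK: "transpose_mat K * M * K = mat_diag (Suc n) (case_nat e l')" .
  have tHK: "transpose_mat (H * K) = transpose_mat K * H"
    using transpose_mult[OF H(1) K] H(2) by simp
  note assoc = assoc_mult_mat[where n\<^sub>1="Suc n" and n\<^sub>2="Suc n" and n\<^sub>3="Suc n" and n\<^sub>4="Suc n"]
  have tKc: "transpose_mat K \<in> carrier_mat (Suc n) (Suc n)" using K by simp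
  have "transpose_mat (H * K) * (H * K) = transpose_mat K * ((H * H) * K)"
    unfolding tHK using H(1) K tKc by (simp add: assoc)
  also have "\<dots> = 1\<^sub>m (Suc n)" using K by (simp add: H(3) KK)
  finally have 1: "transpose_mat (H * K) * (H * K) = 1\<^sub>m (Suc n)" .
  have "transpose_mat (H * K) * G * (H * K) = transpose_mat K * M * K"
    unfolding tHK M_def using H(1) K tKc G by (simp add: assoc)
  with KMK 1 show ?case using H(1) K
    by (intro exI[of _ "H * K"] exI[of _ "case_nat e l'"]) auto
qed

section \<open>Diagonalization of the Gram matrix and the minimax principle\<close>

lemma proots_prod_linear: "proots (\<Prod>x\<leftarrow>xs. [:- x, 1:]) = mset (xs :: real list)"
proof (induction xs)
  case (Cons x xs)
  have "(\<Prod>x\<leftarrow>xs. [:- x, 1:]) \<noteq> 0" by (auto simp: prod_list_zero_iff)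
  thus ?case using Cons by (simp add: proots_mult del: mult_pCons_left)
qed simp

lemma sum_square_mat_vec:
  fixes A :: "nat \<Rightarrow> nat \<Rightarrow> real"
  shows "(\<Sum>i<m. (\<Sum>j<n. A i j * x j)\<^sup>2) = (\<Sum>j<n. \<Sum>k<n. (\<Sum>i<m. A i j * A i k) * (x j * x k))"
proof -
  have "(\<Sum>i<m. (\<Sum>j<n. A i j * x j)\<^sup>2) = (\<Sum>i<m. \<Sum>j<n. \<Sum>k<n. A i j * A i k * (x j * x k))"
    by (simp add: power2_eq_square sum_product mult_ac)
  also have "\<dots> = (\<Sum>j<n. \<Sum>i<m. \<Sum>k<n. A i j * A i k * (x j * x k))" by (rule sum.swap)
  also have "\<dots> = (\<Sum>j<n. \<Sum>k<n. \<Sum>i<m. A i j * A i k * (x j * x k))"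
    by (rule sum.cong[OF refl], rule sum.swap)
  finally show ?thesis by (simp add: sum_distrib_right)
qed

text \<open>Diagonalizing the Gram matrix gives the right singular vectors, the columns of
  \<open>Q\<close>. The left ones are never formed, since the minimax bounds only compare
  \<open>|A x|\<^sup>2\<close> with \<open>|x|\<^sup>2\<close>. The list \<open>es\<close> keeps all
  \<open>n\<close> eigenvalues, whereas \<open>singular_values\<close> cuts at
  \<open>min m n\<close>.\<close>

lemma singular_value_decomposition:
  fixes A :: "real mat"
  assumes A: "A \<in> carrier_mat m n"
  shows "\<exists>es Q. length es = n \<and> sorted_wrt (\<ge>) es \<and> singular_values A = take (min m n) (map sqrt es)
    \<and> (\<forall>k<n. \<forall>l<n. (\<Sum>j<n. Q j k * Q j l) = (if k = l then 1 else 0))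
    \<and> (\<forall>x. (\<Sum>i<m. (\<Sum>j<n. A $$ (i, j) * x j)\<^sup>2) = (\<Sum>k<n. es ! k * (\<Sum>j<n. Q j k * x j)\<^sup>2))
    \<and> (\<forall>x. (\<Sum>j<n. (x j)\<^sup>2) = (\<Sum>k<n. (\<Sum>j<n. Q j k * x j)\<^sup>2))"
proof -
  define G where "G = transpose_mat A * A"
  have G: "G \<in> carrier_mat n n" using A by (simp add: G_def)
  have tG: "transpose_mat G = G" unfolding G_def using A by (subst transpose_mult[of _ n m _ n]) auto
  obtain Q l where Q: "Q \<in> carrier_mat n n" "transpose_mat Q * Q = 1\<^sub>m n"
    and D: "transpose_mat Q * G * Q = mat_diag n l"
    using real_spectral_theorem[OF G tG] by blast
  have tQ: "transpose_mat Q \<in> carrier_mat n n" using Q(1) by simp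
  have QQ: "Q * transpose_mat Q = 1\<^sub>m n" using mat_mult_left_right_inverse[OF tQ Q(1) Q(2)] .
  note assoc = assoc_mult_mat[where n\<^sub>1=n and n\<^sub>2=n and n\<^sub>3=n and n\<^sub>4=n]
  have "Q * mat_diag n l * transpose_mat Q = (Q * transpose_mat Q) * G * (Q * transpose_mat Q)"
    unfolding D[symmetric] using Q(1) tQ G by (simp add: assoc)
  hence G_eq: "G = Q * mat_diag n l * transpose_mat Q" using G by (simp add: QQ)
  have "similar_mat_wit G (mat_diag n l) Q (transpose_mat Q)"
    unfolding similar_mat_wit_def Let_def using G Q tQ QQ G_eq by auto
  hence "char_poly G = char_poly (mat_diag n l)"
    by (intro char_poly_similar) (auto simp: similar_mat_def)
  also have "\<dots> = (\<Prod>a\<leftarrow>diag_mat (mat_diag n l). [:- a, 1:])"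
    by (rule char_poly_upper_triangular[of _ n]) (auto simp: mat_diag_def upper_triangular_def)
  also have "diag_mat (mat_diag n l) = map l [0..<n]"
    by (auto simp: diag_mat_def mat_diag_def)
  finally have proots: "proots (char_poly G) = mset (map l [0..<n])"
    by (simp only: proots_prod_linear)
  define es where "es = rev (sorted_list_of_multiset (proots (char_poly G)))"
  \<comment> \<open>The spectral theorem delivers the diagonal in no particular order. The
    permutation \<open>p\<close> sorts it, and \<open>q\<close> rearranges the columns of
    \<open>Q\<close> accordingly.\<close>
  have "mset es = mset (map l [0..<n])" by (simp add: es_def proots)
  then obtain p where p: "p permutes {..<n}" and es: "permute_list p (map l [0..<n]) = es"
    by (rule mset_eq_permutation) auto
  have len: "length es = n" unfolding es[symmetric] by simp
  have es_nth: "es ! k = l (p k)" if "k < n" for k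
    using that p permutes_in_image[OF p, of k] unfolding es[symmetric] by (subst permute_list_nth) auto
  have sorted: "sorted_wrt (\<ge>) es"
    unfolding es_def sorted_wrt_rev by (simp add: sorted_sorted_list_of_multiset)
  have sv: "singular_values A = take (min m n) (map sqrt es)"
    using A unfolding singular_values_def es_def G_def by (simp add: rev_map)
  define q where "q = (\<lambda>j k. Q $$ (j, p k))"
  have orth: "(\<Sum>j<n. q j k * q j l) = (if k = l then 1 else 0)" if "k < n" "l < n" for k l
  proof -
    have "p k < n" "p l < n" using that permutes_in_image[OF p] by auto
    hence "(\<Sum>j<n. q j k * q j l) = (transpose_mat Q * Q) $$ (p k, p l)"
      using Q(1) by (simp add: q_def scalar_prod_def atLeast0LessThan)
    thus ?thesis using \<open>p k < n\<close> \<open>p l < n\<close> permutes_inj[OF p] by (auto simp: Q(2) inj_eq)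
  qed
  have reindex: "(\<Sum>k<n. f (p k)) = (\<Sum>k<n. f k)" for f :: "nat \<Rightarrow> real"
    using sum.permute[OF p, of f] by simp
  \<comment> \<open>Kept general in the diagonal \<open>c\<close>: the eigenvalues give the formula
    for \<open>|A x|\<^sup>2\<close>, and the constant 1 gives Parseval's identity.\<close>
  have quad: "(\<Sum>k<n. c (p k) * (\<Sum>j<n. q j k * x j)\<^sup>2)
      = (\<Sum>i<n. \<Sum>j<n. (Q * mat_diag n c * transpose_mat Q) $$ (i, j) * (x i * x j))" for c x
  proof -
    have "(\<Sum>k<n. c (p k) * (\<Sum>j<n. q j k * x j)\<^sup>2) = (\<Sum>k<n. c k * (\<Sum>j<n. Q $$ (j, k) * x j)\<^sup>2)"
      unfolding q_def by (rule reindex[of "\<lambda>k. c k * (\<Sum>j<n. Q $$ (j, k) * x j)\<^sup>2"])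
    also have "\<dots> = (\<Sum>k<n. \<Sum>i<n. \<Sum>j<n. Q $$ (i, k) * c k * Q $$ (j, k) * (x i * x j))"
      by (simp add: power2_eq_square sum_product sum_distrib_left mult_ac)
    also have "\<dots> = (\<Sum>i<n. \<Sum>k<n. \<Sum>j<n. Q $$ (i, k) * c k * Q $$ (j, k) * (x i * x j))"
      by (rule sum.swap)
    also have "\<dots> = (\<Sum>i<n. \<Sum>j<n. \<Sum>k<n. Q $$ (i, k) * c k * Q $$ (j, k) * (x i * x j))"
      by (rule sum.cong[OF refl], rule sum.swap)
    also have "\<dots> = (\<Sum>i<n. \<Sum>j<n. (Q * mat_diag n c * transpose_mat Q) $$ (i, j) * (x i * x j))"
      using Q(1) by (intro sum.cong refl)
        (simp add: mat_diag_mult_right[OF Q(1)] scalar_prod_def atLeast0LessThan sum_distrib_right)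
    finally show ?thesis .
  qed
  have "(\<Sum>i<m. (\<Sum>j<n. A $$ (i, j) * x j)\<^sup>2) = (\<Sum>k<n. es ! k * (\<Sum>j<n. q j k * x j)\<^sup>2)" for x
  proof -
    have "(\<Sum>i<m. (\<Sum>j<n. A $$ (i, j) * x j)\<^sup>2) = (\<Sum>i<n. \<Sum>j<n. G $$ (i, j) * (x i * x j))"
      unfolding sum_square_mat_vec G_def using A
      by (intro sum.cong refl) (simp add: scalar_prod_def atLeast0LessThan)
    also have "\<dots> = (\<Sum>k<n. l (p k) * (\<Sum>j<n. q j k * x j)\<^sup>2)" unfolding quad G_eq ..
    also have "\<dots> = (\<Sum>k<n. es ! k * (\<Sum>j<n. q j k * x j)\<^sup>2)" by (simp add: es_nth)
    finally show ?thesis .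
  qed
  moreover have "(\<Sum>j<n. (x j)\<^sup>2) = (\<Sum>k<n. (\<Sum>j<n. q j k * x j)\<^sup>2)" for x
  proof -
    have "(\<Sum>k<n. (\<Sum>j<n. q j k * x j)\<^sup>2) = (\<Sum>i<n. \<Sum>j<n. (1\<^sub>m n :: real mat) $$ (i, j) * (x i * x j))"
      using quad[of "\<lambda>_. 1" x] Q(1) by (simp add: QQ)
    also have "\<dots> = (\<Sum>i<n. \<Sum>j<n. if i = j then x i * x j else 0)"
      by (intro sum.cong refl) auto
    also have "\<dots> = (\<Sum>j<n. (x j)\<^sup>2)" by (simp add: power2_eq_square)
    finally show ?thesis by simp
  qed
  ultimately show ?thesis using len sorted sv orth by blast
qed

text \<open>Half of the Courant-Fischer principle. The columns of \<open>V\<close> span a test space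
  of dimension \<open>r > k\<close> (the positivity says that they are independent), so some nonzero
  test vector is orthogonal to the first \<open>k\<close> right singular vectors, and there
  \<open>|A x|\<^sup>2 \<le> es ! k * |x|\<^sup>2\<close>.\<close>

lemma singular_values_ge:
  fixes A :: "real mat" and V :: "nat \<Rightarrow> nat \<Rightarrow> real"
  assumes A: "A \<in> carrier_mat m n" and k: "k < r" "k < m" "k < n" and s: "s \<ge> 0"
    and V: "\<And>y. \<exists>k<r. y k \<noteq> 0 \<Longrightarrow> 0 < (\<Sum>j<n. (\<Sum>k<r. V j k * y k)\<^sup>2) \<and>
      s\<^sup>2 * (\<Sum>j<n. (\<Sum>k<r. V j k * y k)\<^sup>2) \<le> (\<Sum>i<m. (\<Sum>j<n. A $$ (i, j) * (\<Sum>k<r. V j k * y k))\<^sup>2)"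
  shows "s \<le> singular_values A ! k"
proof -
  obtain es Q where es: "length es = n" "sorted_wrt (\<ge>) es"
    and sv: "singular_values A = take (min m n) (map sqrt es)"
    and Ax: "\<And>x. (\<Sum>i<m. (\<Sum>j<n. A $$ (i, j) * x j)\<^sup>2) = (\<Sum>k<n. es ! k * (\<Sum>j<n. Q j k * x j)\<^sup>2)"
    and xx: "\<And>x. (\<Sum>j<n. (x j)\<^sup>2) = (\<Sum>k<n. (\<Sum>j<n. Q j k * x j)\<^sup>2)"
    using singular_value_decomposition[OF A] by blast
  have "s\<^sup>2 \<le> es ! k"
  proof (rule ccontr)
    assume less: "\<not> s\<^sup>2 \<le> es ! k"
    obtain y where y: "\<exists>j<r. y j \<noteq> 0"
      and 0: "\<And>i. i < k \<Longrightarrow> (\<Sum>l<r. (\<Sum>j<n. Q j i * V j l) * y l) = 0"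
      using exists_nonzero_solution[OF k(1), of "\<lambda>i l. \<Sum>j<n. Q j i * V j l"] by blast
    define x where "x = (\<lambda>j. \<Sum>l<r. V j l * y l)"
    have c0: "(\<Sum>j<n. Q j i * x j) = 0" if "i < k" for i
    proof -
      have "(\<Sum>j<n. Q j i * x j) = (\<Sum>l<r. (\<Sum>j<n. Q j i * V j l) * y l)"
        unfolding x_def sum_distrib_left sum_distrib_right
        by (subst sum.swap) (simp add: mult_ac)
      thus ?thesis using 0[OF that] by simp
    qed
    have pos: "0 < (\<Sum>j<n. (x j)\<^sup>2)" and ge: "s\<^sup>2 * (\<Sum>j<n. (x j)\<^sup>2) \<le> (\<Sum>i<m. (\<Sum>j<n. A $$ (i, j) * x j)\<^sup>2)"
      using V[OF y] unfolding x_def by auto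
    have "(\<Sum>i<m. (\<Sum>j<n. A $$ (i, j) * x j)\<^sup>2) \<le> (\<Sum>i<n. es ! k * (\<Sum>j<n. Q j i * x j)\<^sup>2)"
      unfolding Ax
    proof (rule sum_mono)
      fix i assume "i \<in> {..<n}"
      thus "es ! i * (\<Sum>j<n. Q j i * x j)\<^sup>2 \<le> es ! k * (\<Sum>j<n. Q j i * x j)\<^sup>2"
        using c0[of i] es k sorted_wrt_nth_less[OF es(2), of k i]
        by (cases "i < k"; cases "i = k") (auto intro!: mult_right_mono)
    qed
    also have "\<dots> = es ! k * (\<Sum>j<n. (x j)\<^sup>2)" by (simp add: xx[of x] sum_distrib_left)
    also have "\<dots> < s\<^sup>2 * (\<Sum>j<n. (x j)\<^sup>2)" using less pos by (intro mult_strict_right_mono) auto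
    finally show False using ge by simp
  qed
  hence "s \<le> sqrt (es ! k)" using s by (simp add: real_le_rsqrt)
  thus ?thesis using k es by (simp add: sv)
qed

text \<open>The other half: the span of the first \<open>k + 1\<close> right singular vectors is too
  large to avoid the common kernel of \<open>r \<le> k\<close> functionals, and on it
  \<open>|A x|\<^sup>2 \<ge> es ! k * |x|\<^sup>2\<close>.\<close>

lemma singular_values_le:
  fixes A :: "real mat" and R :: "nat \<Rightarrow> nat \<Rightarrow> real"
  assumes A: "A \<in> carrier_mat m n" and k: "r \<le> k" "k < m" "k < n" and s: "s \<ge> 0"
    and R: "\<And>x. (\<And>i. i < r \<Longrightarrow> (\<Sum>j<n. R i j * x j) = 0) \<Longrightarrow>
      (\<Sum>i<m. (\<Sum>j<n. A $$ (i, j) * x j)\<^sup>2) \<le> s\<^sup>2 * (\<Sum>j<n. (x j)\<^sup>2)"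
  shows "singular_values A ! k \<le> s"
proof -
  obtain es Q where es: "length es = n" "sorted_wrt (\<ge>) es"
    and sv: "singular_values A = take (min m n) (map sqrt es)"
    and orth: "\<And>k l. k < n \<Longrightarrow> l < n \<Longrightarrow> (\<Sum>j<n. Q j k * Q j l) = (if k = l then 1 else 0)"
    and Ax: "\<And>x. (\<Sum>i<m. (\<Sum>j<n. A $$ (i, j) * x j)\<^sup>2) = (\<Sum>k<n. es ! k * (\<Sum>j<n. Q j k * x j)\<^sup>2)"
    and xx: "\<And>x. (\<Sum>j<n. (x j)\<^sup>2) = (\<Sum>k<n. (\<Sum>j<n. Q j k * x j)\<^sup>2)"
    using singular_value_decomposition[OF A] by blast
  have "es ! k \<le> s\<^sup>2"
  proof (rule ccontr)
    assume less: "\<not> es ! k \<le> s\<^sup>2"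
    obtain y where y: "\<exists>j<Suc k. y j \<noteq> 0"
      and 0: "\<And>i. i < r \<Longrightarrow> (\<Sum>l<Suc k. (\<Sum>j<n. R i j * Q j l) * y l) = 0"
      using exists_nonzero_solution[of r "Suc k" "\<lambda>i l. \<Sum>j<n. R i j * Q j l"] k by auto
    define x where "x = (\<lambda>j. \<Sum>l<Suc k. Q j l * y l)"
    have swap: "(\<Sum>j<n. f j * x j) = (\<Sum>l<Suc k. (\<Sum>j<n. f j * Q j l) * y l)" for f
      unfolding x_def sum_distrib_left sum_distrib_right
      by (subst sum.swap) (simp add: mult_ac)
    have c: "(\<Sum>j<n. Q j i * x j) = (if i \<le> k then y i else 0)" if "i < n" for i
    proof -
      have "(\<Sum>j<n. Q j i * x j) = (\<Sum>l<Suc k. if l = i then y l else 0)"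
        unfolding swap using that k by (intro sum.cong) (auto simp: orth)
      also have "\<dots> = (if i \<le> k then y i else 0)" by (subst sum.delta) auto
      finally show ?thesis .
    qed
    obtain i0 where "i0 < Suc k" and yi0: "y i0 \<noteq> 0" using y by blast
    hence i0: "i0 \<le> k" by simp
    have pos: "0 < (\<Sum>j<n. (x j)\<^sup>2)" unfolding xx[of x]
      by (rule sum_pos2[of _ i0]) (use i0 yi0 k c[of i0] in auto)
    have "es ! k * (\<Sum>j<n. (x j)\<^sup>2) \<le> (\<Sum>i<m. (\<Sum>j<n. A $$ (i, j) * x j)\<^sup>2)"
      unfolding Ax xx[of x] sum_distrib_left
    proof (rule sum_mono)
      fix i assume "i \<in> {..<n}"
      thus "es ! k * (\<Sum>j<n. Q j i * x j)\<^sup>2 \<le> es ! i * (\<Sum>j<n. Q j i * x j)\<^sup>2"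
        using c[of i] es k sorted_wrt_nth_less[OF es(2), of i k]
        by (cases "i < k"; cases "i = k") (auto intro!: mult_right_mono)
    qed
    also have "\<dots> \<le> s\<^sup>2 * (\<Sum>j<n. (x j)\<^sup>2)" by (rule R) (simp add: swap 0 del: sum.lessThan_Suc)
    also have "\<dots> < es ! k * (\<Sum>j<n. (x j)\<^sup>2)" using less pos by (intro mult_strict_right_mono) auto
    finally show False by simp
  qed
  hence "sqrt (es ! k) \<le> s" using s by (simp add: real_le_lsqrt)
  thus ?thesis using k es by (simp add: sv)
qed

section \<open>Rank factorization\<close>

text \<open>An injective matrix has an invertible Gram matrix, hence a left inverse
  \<open>L\<close>. Cauchy-Schwarz in each row of \<open>y = L (F y)\<close> bounds
  \<open>|y|\<^sup>2\<close> by the squared Frobenius norm of \<open>L\<close> times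
  \<open>|F y|\<^sup>2\<close>.\<close>

lemma left_inverse_bound:
  fixes F :: "nat \<Rightarrow> nat \<Rightarrow> real"
  assumes inj: "\<And>y. (\<And>i. i < a \<Longrightarrow> (\<Sum>k<r. F i k * y k) = 0) \<Longrightarrow> (\<forall>k<r. y k = 0)"
  shows "\<exists>\<kappa>>0. \<forall>y. \<kappa> * (\<Sum>k<r. (y k)\<^sup>2) \<le> (\<Sum>i<a. (\<Sum>k<r. F i k * y k)\<^sup>2)"
proof -
  define A where "A = Matrix.mat a r (\<lambda>(i, k). F i k)"
  have A: "A \<in> carrier_mat a r" by (simp add: A_def)
  define G where "G = transpose_mat A * A"
  have G: "G \<in> carrier_mat r r" using A by (simp add: G_def)
  have Av: "vec_index (A *\<^sub>v v) i = (\<Sum>k<r. F i k * vec_index v k)" if "v \<in> carrier_vec r" "i < a" for v i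
    using that by (simp add: A_def scalar_prod_def atLeast0LessThan)
  have "Determinant.det G \<noteq> 0"
  proof
    assume "Determinant.det G = 0"
    then obtain v where v: "v \<in> carrier_vec r" "v \<noteq> 0\<^sub>v r" "G *\<^sub>v v = 0\<^sub>v r"
      using det_0_iff_vec_prod_zero[OF G] by blast
    have "0 = v \<bullet> (G *\<^sub>v v)" using v by simp
    also have "G *\<^sub>v v = transpose_mat A *\<^sub>v (A *\<^sub>v v)"
      unfolding G_def using A v by (simp add: assoc_mult_mat_vec[of _ r a _ r])
    also have "v \<bullet> \<dots> = (A *\<^sub>v v) \<bullet> (A *\<^sub>v v)"
      using transpose_vec_mult_scalar[OF A v(1), of "A *\<^sub>v v"] A v
      by (subst comm_scalar_prod[of _ r]) auto
    also have "\<dots> = (\<Sum>i<a. (vec_index (A *\<^sub>v v) i)\<^sup>2)"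
      using A by (simp add: scalar_prod_def atLeast0LessThan power2_eq_square)
    finally have "\<forall>i\<in>{..<a}. (vec_index (A *\<^sub>v v) i)\<^sup>2 = 0"
      by (subst sum_nonneg_eq_0_iff[symmetric]) auto
    hence "\<forall>k<r. vec_index v k = 0"
      by (intro inj) (use Av[OF v(1)] in simp)
    thus False using v(1,2) by (metis carrier_vecD eq_vecI index_zero_vec(1) index_zero_vec(2))
  qed
  then obtain B where B: "B \<in> carrier_mat r r" "B * G = 1\<^sub>m r"
    using det_non_zero_imp_unit[OF G] by (auto simp: Units_def ring_mat_def)
  define L where "L = B * transpose_mat A"
  have L: "L \<in> carrier_mat r a" "L * A = 1\<^sub>m r"
    using A B by (auto simp: L_def G_def assoc_mult_mat[of _ r r _ a _ r])
  define N where "N = (\<Sum>k<r. \<Sum>i<a. (L $$ (k, i))\<^sup>2)"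
  have N: "N \<ge> 0" unfolding N_def by (intro sum_nonneg) auto
  show ?thesis
  \<comment> \<open>The \<open>+ 1\<close> keeps the constant positive when \<open>r = 0\<close>,
    where \<open>N\<close> is an empty sum.\<close>
  proof (intro exI[of _ "1 / (N + 1)"] conjI allI)
    fix y :: "nat \<Rightarrow> real"
    define S where "S = (\<Sum>i<a. (\<Sum>k<r. F i k * y k)\<^sup>2)"
    have S: "S \<ge> 0" unfolding S_def by (intro sum_nonneg) auto
    have y: "y k = (\<Sum>i<a. L $$ (k, i) * (\<Sum>l<r. F i l * y l))" if "k < r" for k
    proof -
      have "(\<Sum>i<a. L $$ (k, i) * (\<Sum>l<r. F i l * y l)) = (\<Sum>l<r. (\<Sum>i<a. L $$ (k, i) * F i l) * y l)"
        unfolding sum_distrib_left sum_distrib_right by (subst sum.swap) (simp add: mult_ac)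
      also have "\<dots> = (\<Sum>l<r. (L * A) $$ (k, l) * y l)"
        using that L(1) by (intro sum.cong refl) (simp add: A_def scalar_prod_def atLeast0LessThan)
      also have "\<dots> = (\<Sum>l<r. if k = l then y l else 0)"
        unfolding L(2) using that by (intro sum.cong refl) simp
      also have "\<dots> = y k" using that by simp
      finally show ?thesis by simp
    qed
    have "(\<Sum>k<r. (y k)\<^sup>2) \<le> (\<Sum>k<r. (\<Sum>i<a. (L $$ (k, i))\<^sup>2) * S)"
    proof (rule sum_mono)
      fix k assume "k \<in> {..<r}"
      thus "(y k)\<^sup>2 \<le> (\<Sum>i<a. (L $$ (k, i))\<^sup>2) * S"
        unfolding S_def using Cauchy_Schwarz_ineq_sum[of "\<lambda>i. L $$ (k, i)" "\<lambda>i. \<Sum>l<r. F i l * y l" "{..<a}"]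
        by (subst y) auto
    qed
    also have "\<dots> = N * S" by (simp add: N_def sum_distrib_right)
    also have "\<dots> \<le> (N + 1) * S" using S by (simp add: algebra_simps)
    finally show "1 / (N + 1) * (\<Sum>k<r. (y k)\<^sup>2) \<le> (\<Sum>i<a. (\<Sum>k<r. F i k * y k)\<^sup>2)"
      using N unfolding S_def by (simp add: field_simps)
  qed (use N in auto)
qed

text \<open>A maximal independent set of columns of \<open>P\<close> has \<open>r\<close> members
  and spans all columns: \<open>f\<close> lists their indices, and \<open>g\<close> holds the
  coordinates of every column. Taking the left factor from the columns of \<open>P\<close> itself
  allows test vectors supported on the column blocks \<open>f k\<close>.\<close>

lemma rank_factorization:
  fixes P :: "real mat"
  assumes P: "P \<in> carrier_mat a b" and rank: "vec_space.rank a P = r"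
  shows "\<exists>f g \<kappa>. r \<le> a \<and> r \<le> b \<and> \<kappa> > 0 \<and> (\<forall>k<r. f k < b) \<and> inj_on f {..<r}
    \<and> (\<forall>i<a. \<forall>j<b. P $$ (i, j) = (\<Sum>k<r. P $$ (i, f k) * g k j))
    \<and> (\<forall>y. \<kappa> * (\<Sum>k<r. (y k)\<^sup>2) \<le> (\<Sum>i<a. (\<Sum>k<r. P $$ (i, f k) * y k)\<^sup>2))"
proof -
  interpret vec_space "TYPE(real)" a .
  have "lin_indpt {}" using finite_lin_indpt2[of "{}"] by auto
  then obtain S where S: "finite S" "maximal S (\<lambda>T. T \<subseteq> set (cols P) \<and> lin_indpt T)"
    using maximal_exists_superset[of "set (cols P)" "\<lambda>T. T \<subseteq> set (cols P) \<and> lin_indpt T" "{}"] by blast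
  have cP: "set (cols P) \<subseteq> carrier_vec a" using P cols_dim[of P] by auto
  have S': "S \<subseteq> set (cols P)" "lin_indpt S" using S(2) by (auto simp: maximal_def)
  have Sc: "S \<subseteq> carrier_vec a" using S' cP by auto
  have card: "card S = r" using rank_card_indpt[OF P S(2)] rank by simp
  obtain ss where ss: "set ss = S" "distinct ss" using finite_distinct_list[OF S(1)] by blast
  have len: "length ss = r" using card ss distinct_card by metis
  define R where "R = mat_of_cols a ss"
  have R: "R \<in> carrier_mat a r" "cols R = ss" using ss Sc len by (auto simp: R_def)
  have "\<exists>j<b. ss ! k = col P j" if "k < r" for k
  proof -
    have "ss ! k \<in> set (cols P)" using that len ss S' by (metis nth_mem subsetD)
    thus ?thesis using P by (auto simp: in_set_conv_nth)
  qed
  then obtain f where f: "\<And>k. k < r \<Longrightarrow> f k < b" "\<And>k. k < r \<Longrightarrow> ss ! k = col P (f k)" by metis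
  have inj: "inj_on f {..<r}"
    using f ss(2) len by (intro inj_onI) (metis lessThan_iff nth_eq_iff_index_eq)
  have Rf: "R $$ (i, k) = P $$ (i, f k)" if "i < a" "k < r" for i k
    using that f[of k] P len by (simp add: R_def mat_of_cols_index)
  have span: "\<exists>g. \<forall>i<a. P $$ (i, j) = (\<Sum>k<r. P $$ (i, f k) * g k)" if j: "j < b" for j
  proof -
    have v: "col P j \<in> set (cols P)" "col P j \<in> carrier_vec a" using j P by (auto simp: cols_def)
    have "col P j \<in> span S"
    proof (cases "col P j \<in> S")
      case True thus ?thesis using in_own_span[OF Sc] by auto
    next
      case False
      \<comment> \<open>Maximality: an independent enlargement of \<open>S\<close> by a column of
        \<open>P\<close> would have to equal \<open>S\<close>.\<close>
      have "lin_dep (S \<union> {col P j})"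
      proof (rule ccontr)
        assume "\<not> ?thesis"
        hence "S \<union> {col P j} = S" using S(2) v(1) S'(1) unfolding maximal_def by blast
        thus False using False by blast
      qed
      thus ?thesis using lin_dep_iff_in_span[OF Sc S'(2) _ False] v(2) by auto
    qed
    then obtain c where c: "col P j = lincomb c S"
      using finite_span[OF S(1) Sc] by auto
    have "lincomb c S = R *\<^sub>v (Matrix.vec r (\<lambda>i. c (col R i)))"
      using mat_mult_eq_lincomb[OF R(1), of c] R(2) ss by simp
    hence "vec_index (col P j) i = (\<Sum>k<r. P $$ (i, f k) * c (col R k))" if "i < a" for i
      using that R(1) unfolding c by (simp add: scalar_prod_def atLeast0LessThan Rf)
    thus ?thesis using P j by (intro exI[of _ "\<lambda>k. c (col R k)"]) auto
  qed
  then obtain g where g: "\<And>i j. i < a \<Longrightarrow> j < b \<Longrightarrow> P $$ (i, j) = (\<Sum>k<r. P $$ (i, f k) * g j k)"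
    by metis
  have indep: "\<forall>k<r. y k = 0" if 0: "\<And>i. i < a \<Longrightarrow> (\<Sum>k<r. P $$ (i, f k) * y k) = 0" for y
  proof (rule ccontr)
    assume "\<not> ?thesis"
    hence "Matrix.vec r y \<noteq> 0\<^sub>v r" by (metis index_vec index_zero_vec(1))
    moreover have "R *\<^sub>v Matrix.vec r y = 0\<^sub>v a"
      using R(1) 0 by (intro eq_vecI) (simp_all add: scalar_prod_def atLeast0LessThan Rf)
    ultimately have "lin_dep (set (cols R))" using lin_depI[OF R(1), of "Matrix.vec r y"] R(2) ss by simp
    thus False using S'(2) R(2) ss by simp
  qed
  have "r \<le> a"
  proof (rule ccontr)
    assume "\<not> r \<le> a"
    then obtain x where "\<exists>j<r. x j \<noteq> 0" "\<And>i. i < a \<Longrightarrow> (\<Sum>k<r. P $$ (i, f k) * x k) = 0"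
      using exists_nonzero_solution[of a r "\<lambda>i k. P $$ (i, f k)"] by auto
    thus False using indep by blast
  qed
  have "r \<le> b" using rank_le_nc[OF P] rank by simp
  obtain \<kappa> where \<kappa>: "\<kappa> > 0"
    "\<forall>y. \<kappa> * (\<Sum>k<r. (y k)\<^sup>2) \<le> (\<Sum>i<a. (\<Sum>k<r. P $$ (i, f k) * y k)\<^sup>2)"
    using left_inverse_bound[where F = "\<lambda>i k. P $$ (i, f k)" and a = a and r = r, OF indep] by auto
  have "\<forall>i<a. \<forall>j<b. P $$ (i, j) = (\<Sum>k<r. P $$ (i, f k) * g j k)"
    using g by fast
  have "\<forall>k<r. f k < b" using f(1) by blast
  show ?thesis
    by (intro exI[of _ f] exI[of _ "\<lambda>k j. g j k"] exI[of _ \<kappa>] conjI; fact)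
qed

section \<open>Perturbed block matrices\<close>

text \<open>This quadratic form of the operator norm bound \<open>\<parallel>F\<parallel> \<le> s\<close> is additive in \<open>F\<close> and
  needs no normalization of the vectors.\<close>

definition bilinear_bound :: "nat \<Rightarrow> nat \<Rightarrow> (nat \<Rightarrow> nat \<Rightarrow> real) \<Rightarrow> real \<Rightarrow> bool" where
  "bilinear_bound m n F s \<longleftrightarrow> (\<forall>x y. (\<Sum>i<m. \<Sum>j<n. F i j * (y i * x j))
     \<le> s / 2 * ((\<Sum>i<m. (y i)\<^sup>2) + (\<Sum>j<n. (x j)\<^sup>2)))"

lemma bilinear_bound_add:
  assumes "bilinear_bound m n F s" "bilinear_bound m n G t"
  shows "bilinear_bound m n (\<lambda>i j. F i j + G i j) (s + t)"
  unfolding bilinear_bound_def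
proof (intro allI)
  fix x y :: "nat \<Rightarrow> real"
  have "(\<Sum>i<m. \<Sum>j<n. (F i j + G i j) * (y i * x j))
      = (\<Sum>i<m. \<Sum>j<n. F i j * (y i * x j)) + (\<Sum>i<m. \<Sum>j<n. G i j * (y i * x j))"
    by (simp add: distrib_right sum.distrib)
  also have "\<dots> \<le> s / 2 * ((\<Sum>i<m. (y i)\<^sup>2) + (\<Sum>j<n. (x j)\<^sup>2)) + t / 2 * ((\<Sum>i<m. (y i)\<^sup>2) + (\<Sum>j<n. (x j)\<^sup>2))"
    using assms unfolding bilinear_bound_def by (intro add_mono) blast+
  finally show "(\<Sum>i<m. \<Sum>j<n. (F i j + G i j) * (y i * x j)) \<le> (s + t) / 2 * ((\<Sum>i<m. (y i)\<^sup>2) + (\<Sum>j<n. (x j)\<^sup>2))"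
    by (simp add: algebra_simps add_divide_distrib)
qed

text \<open>Testing the form with \<open>y = F x / s\<close> makes its value
  \<open>|F x|\<^sup>2 / s\<close>; this scale of \<open>y\<close> recovers the operator norm bound
  without loss in the constant.\<close>

lemma bilinear_bound_norm:
  assumes F: "bilinear_bound m n F s" and s: "s > 0"
  shows "(\<Sum>i<m. (\<Sum>j<n. F i j * x j)\<^sup>2) \<le> s\<^sup>2 * (\<Sum>j<n. (x j)\<^sup>2)"
proof -
  define N where "N = (\<Sum>i<m. (\<Sum>j<n. F i j * x j)\<^sup>2)"
  define X where "X = (\<Sum>j<n. (x j)\<^sup>2)"
  define y where "y = (\<lambda>i. (\<Sum>j<n. F i j * x j) / s)"
  have "(\<Sum>i<m. \<Sum>j<n. F i j * (y i * x j)) = (\<Sum>i<m. y i * (\<Sum>j<n. F i j * x j))"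
    by (simp add: sum_distrib_left mult_ac)
  also have "\<dots> = N / s"
    unfolding N_def y_def power2_eq_square times_divide_eq_left sum_divide_distrib[symmetric] ..
  finally have eq: "(\<Sum>i<m. \<Sum>j<n. F i j * (y i * x j)) = N / s" .
  have "N / s \<le> s / 2 * ((\<Sum>i<m. (y i)\<^sup>2) + X)"
    unfolding eq[symmetric] X_def by (rule F[unfolded bilinear_bound_def, THEN spec, THEN spec])
  also have "(\<Sum>i<m. (y i)\<^sup>2) = N / s\<^sup>2"
    unfolding N_def y_def power_divide sum_divide_distrib[symmetric] ..
  finally have "2 * s * (N / s) \<le> 2 * s * (s / 2 * (N / s\<^sup>2 + X))"
    using s by (intro mult_left_mono) auto
  moreover have "2 * s * (N / s) = 2 * N" using s by simp
  moreover have "2 * s * (s / 2 * (N / s\<^sup>2 + X)) = N + s\<^sup>2 * X"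
    unfolding distrib_left using s by (simp add: power2_eq_square)
  ultimately have "N \<le> s\<^sup>2 * X" by linarith
  thus ?thesis by (simp add: N_def X_def)
qed

text \<open>A Schur test: AM-GM with the non-negative weights \<open>B i j\<close> splits each term
  into squares, and summing these produces the scaled row and column sums.\<close>

lemma bilinear_bound_row_col_sums:
  assumes B: "\<And>i j. i < m \<Longrightarrow> j < n \<Longrightarrow> 0 \<le> B i j"
    and row: "\<And>i. i < m \<Longrightarrow> (u i)\<^sup>2 * (\<Sum>j<n. B i j) \<le> s"
    and col: "\<And>j. j < n \<Longrightarrow> (v j)\<^sup>2 * (\<Sum>i<m. B i j) \<le> s"
  shows "bilinear_bound m n (\<lambda>i j. u i * B i j * v j) s"
  unfolding bilinear_bound_def
proof (intro allI)
  fix x y :: "nat \<Rightarrow> real"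
  have "(\<Sum>i<m. \<Sum>j<n. u i * B i j * v j * (y i * x j))
     \<le> (\<Sum>i<m. \<Sum>j<n. B i j * (u i)\<^sup>2 * (y i)\<^sup>2 / 2 + B i j * (v j)\<^sup>2 * (x j)\<^sup>2 / 2)"
  proof (intro sum_mono)
    fix i j assume ij: "i \<in> {..<m}" "j \<in> {..<n}"
    have "B i j * (2 * ((u i * y i) * (v j * x j))) \<le> B i j * ((u i * y i)\<^sup>2 + (v j * x j)\<^sup>2)"
      using B ij sum_squares_bound[of "u i * y i" "v j * x j"] by (intro mult_left_mono) (auto simp: mult_ac)
    thus "u i * B i j * v j * (y i * x j) \<le> B i j * (u i)\<^sup>2 * (y i)\<^sup>2 / 2 + B i j * (v j)\<^sup>2 * (x j)\<^sup>2 / 2"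
      by (simp add: algebra_simps power_mult_distrib)
  qed
  also have "\<dots> = (\<Sum>i<m. (u i)\<^sup>2 * (\<Sum>j<n. B i j) * (y i)\<^sup>2 / 2) + (\<Sum>i<m. \<Sum>j<n. B i j * (v j)\<^sup>2 * (x j)\<^sup>2 / 2)"
    by (simp add: sum.distrib sum_distrib_left sum_distrib_right sum_divide_distrib mult_ac)
  also have "(\<Sum>i<m. \<Sum>j<n. B i j * (v j)\<^sup>2 * (x j)\<^sup>2 / 2) = (\<Sum>j<n. (v j)\<^sup>2 * (\<Sum>i<m. B i j) * (x j)\<^sup>2 / 2)"
    by (subst sum.swap) (simp add: sum_distrib_left sum_distrib_right sum_divide_distrib mult_ac)
  also have "(\<Sum>i<m. (u i)\<^sup>2 * (\<Sum>j<n. B i j) * (y i)\<^sup>2 / 2) + \<dots> \<le> (\<Sum>i<m. s * (y i)\<^sup>2 / 2) + (\<Sum>j<n. s * (x j)\<^sup>2 / 2)"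
    using row col by (intro add_mono sum_mono divide_right_mono mult_right_mono) auto
  also have "\<dots> = s / 2 * ((\<Sum>i<m. (y i)\<^sup>2) + (\<Sum>j<n. (x j)\<^sup>2))"
    by (simp add: sum_distrib_left distrib_left)
  finally show "(\<Sum>i<m. \<Sum>j<n. u i * B i j * v j * (y i * x j)) \<le> s / 2 * ((\<Sum>i<m. (y i)\<^sup>2) + (\<Sum>j<n. (x j)\<^sup>2))" .
qed

text \<open>The norm bound for \<open>W\<close> is applied to the rescaled vectors
  \<open>u i * y i\<close> and \<open>v j * x j\<close>; AM-GM then converts the product of norms
  into the additive form of \<open>bilinear_bound\<close>.\<close>

lemma bilinear_bound_scale:
  assumes W: "\<And>x y. (\<Sum>i<m. \<Sum>j<n. W i j * (y i * x j)) \<le> T * sqrt (\<Sum>i<m. (y i)\<^sup>2) * sqrt (\<Sum>j<n. (x j)\<^sup>2)"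
    and T: "T \<ge> 0" and u: "\<And>i. i < m \<Longrightarrow> (u i)\<^sup>2 \<le> U" and v: "\<And>j. j < n \<Longrightarrow> (v j)\<^sup>2 \<le> V"
    and U: "U \<ge> 0" and V: "V \<ge> 0" and s: "T * sqrt (U * V) \<le> s"
  shows "bilinear_bound m n (\<lambda>i j. u i * W i j * v j) s"
  unfolding bilinear_bound_def
proof (intro allI)
  fix x y :: "nat \<Rightarrow> real"
  define X where "X = (\<Sum>j<n. (x j)\<^sup>2)"
  define Y where "Y = (\<Sum>i<m. (y i)\<^sup>2)"
  have XY: "X \<ge> 0" "Y \<ge> 0" unfolding X_def Y_def by (auto intro: sum_nonneg)
  have Y': "(\<Sum>i<m. (u i * y i)\<^sup>2) \<le> U * Y"
    unfolding Y_def sum_distrib_left power_mult_distrib using u by (intro sum_mono mult_right_mono) auto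
  have X': "(\<Sum>j<n. (v j * x j)\<^sup>2) \<le> V * X"
    unfolding X_def sum_distrib_left power_mult_distrib using v by (intro sum_mono mult_right_mono) auto
  have "(\<Sum>i<m. \<Sum>j<n. u i * W i j * v j * (y i * x j)) = (\<Sum>i<m. \<Sum>j<n. W i j * ((u i * y i) * (v j * x j)))"
    by (simp add: mult_ac)
  also have "\<dots> \<le> T * sqrt (\<Sum>i<m. (u i * y i)\<^sup>2) * sqrt (\<Sum>j<n. (v j * x j)\<^sup>2)"
    by (rule W)
  also have "\<dots> \<le> T * sqrt (U * Y) * sqrt (V * X)"
    using T U XY X' Y' by (intro mult_mono real_sqrt_le_mono) (auto intro: sum_nonneg)
  also have "\<dots> = T * sqrt (U * V) * sqrt (X * Y)" by (simp add: real_sqrt_mult)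
  also have "\<dots> \<le> s * sqrt (X * Y)" using s XY by (intro mult_right_mono) auto
  also have "\<dots> \<le> s * ((Y + X) / 2)"
  proof (rule mult_left_mono)
    show "sqrt (X * Y) \<le> (Y + X) / 2" using arith_geo_mean_sqrt[of X Y] XY by (simp add: add.commute)
    have "0 \<le> T * sqrt (U * V)" using T U V by simp
    thus "0 \<le> s" using s by linarith
  qed
  finally show "(\<Sum>i<m. \<Sum>j<n. u i * W i j * v j * (y i * x j)) \<le> s / 2 * ((\<Sum>i<m. (y i)\<^sup>2) + (\<Sum>j<n. (x j)\<^sup>2))"
    by (simp add: X_def Y_def)
qed

section \<open>Singular values of blockwise constant matrices with noise\<close>

lemma sum_group_labels:
  fixes h :: "nat \<Rightarrow> real"
  assumes "\<And>i. i < m \<Longrightarrow> l i < a"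
  shows "(\<Sum>i<m. w i * h (l i)) = (\<Sum>k<a. (\<Sum>i<m. if l i = k then w i else 0) * h k)"
proof -
  have "(\<Sum>k<a. (\<Sum>i<m. if l i = k then w i else 0) * h k) = (\<Sum>i<m. \<Sum>k<a. if k = l i then w i * h k else 0)"
    unfolding sum_distrib_right by (subst sum.swap) (intro sum.cong refl, auto)
  also have "\<dots> = (\<Sum>i<m. w i * h (l i))" using assms by (intro sum.cong refl) (simp add: sum.delta)
  finally show ?thesis by simp
qed

text \<open>On the test space the structured part expands by at least
  \<open>sqrt (S * T * \<kappa>)\<close>: the factors come from the weight of \<open>u\<close> on
  every row block, the weight of \<open>v\<close> on every column block, and the independence of the
  pattern columns \<open>f k\<close>. By the triangle inequality the noise costs at most
  \<open>\<eta>\<close>.\<close>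

lemma blocks_singular_values_lower:
  fixes p w :: "nat \<Rightarrow> nat \<Rightarrow> real"
  assumes A: "A \<in> carrier_mat m n"
    and A_eq: "\<And>i j. i < m \<Longrightarrow> j < n \<Longrightarrow> A $$ (i, j) = u i * p (li i) (lj j) * v j + w i j"
    and li: "\<And>i. i < m \<Longrightarrow> li i < a" and lj: "\<And>j. j < n \<Longrightarrow> lj j < b"
    and f: "\<And>k. k < r \<Longrightarrow> f k < b" "inj_on f {..<r}"
    and \<kappa>: "\<kappa> > 0" "\<And>y. \<kappa> * (\<Sum>k<r. (y k)\<^sup>2) \<le> (\<Sum>i<a. (\<Sum>k<r. p i (f k) * y k)\<^sup>2)"
    and S: "S > 0" "\<And>k. k < a \<Longrightarrow> S \<le> (\<Sum>i<m. if li i = k then (u i)\<^sup>2 else 0)"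
    and T: "T > 0" "\<And>k. k < b \<Longrightarrow> T \<le> (\<Sum>j<n. if lj j = k then (v j)\<^sup>2 else 0)"
    and w: "bilinear_bound m n w \<eta>" and \<eta>: "\<eta> > 0" "\<eta> \<le> sqrt (S * T * \<kappa>)"
    and k: "k < r" "k < m" "k < n"
  shows "sqrt (S * T * \<kappa>) - \<eta> \<le> singular_values A ! k"
proof -
  define t where "t = (\<lambda>k. \<Sum>j<n. if lj j = f k then (v j)\<^sup>2 else 0)"
  have t: "t k \<ge> T" if "k < r" for k using T(2)[OF f(1)[OF that]] by (simp add: t_def)
  \<comment> \<open>The column space of \<open>V\<close> is the \<open>r\<close>-dimensional test space: the weights \<open>v j / t k\<close> are chosen
    so that the structured part maps \<open>V y\<close> to \<open>u i * (\<Sum>k<r. p (li i) (f k) * y k)\<close>.\<close>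
  define V where "V = (\<lambda>j k. if lj j = f k then v j / t k else 0)"
  define \<delta> where "\<delta> = sqrt (S * T * \<kappa>)"
  show ?thesis unfolding \<delta>_def[symmetric]
  proof (rule singular_values_ge[OF A k, of _ V])
    show "0 \<le> \<delta> - \<eta>" using \<eta> by (simp add: \<delta>_def)
    fix y :: "nat \<Rightarrow> real" assume y: "\<exists>k<r. y k \<noteq> 0"
    define x where "x = (\<lambda>j. \<Sum>k<r. V j k * y k)"
    \<comment> \<open>Since \<open>f\<close> is injective, \<open>lj j = f k\<close> for at most one
      \<open>k\<close>, so squaring creates no cross terms.\<close>
    have x2: "(x j)\<^sup>2 = (\<Sum>k<r. (V j k)\<^sup>2 * (y k)\<^sup>2)" for j
    proof (cases "\<exists>k<r. lj j = f k")
      case True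
      then obtain k0 where k0: "k0 < r" "lj j = f k0" by blast
      have "V j k = 0" if "k < r" "k \<noteq> k0" for k
        using that k0 f(2) by (auto simp: V_def inj_on_def)
      hence "x j = V j k0 * y k0" "(\<Sum>k<r. (V j k)\<^sup>2 * (y k)\<^sup>2) = (V j k0)\<^sup>2 * (y k0)\<^sup>2"
        unfolding x_def using k0 by (auto intro!: sum.remove[THEN trans] simp: sum.remove[of _ k0])
      thus ?thesis by (simp add: power_mult_distrib)
    qed (auto simp: x_def V_def)
    have "(\<Sum>j<n. (x j)\<^sup>2) = (\<Sum>k<r. (\<Sum>j<n. (V j k)\<^sup>2) * (y k)\<^sup>2)"
      unfolding x2 sum_distrib_right by (rule sum.swap)
    also have "\<dots> = (\<Sum>k<r. (y k)\<^sup>2 / t k)"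
    proof (intro sum.cong refl)
      fix k assume "k \<in> {..<r}"
      hence "t k > 0" using t[of k] T by auto
      have "(\<Sum>j<n. (V j k)\<^sup>2) = (\<Sum>j<n. (if lj j = f k then (v j)\<^sup>2 else 0) / (t k)\<^sup>2)"
        by (intro sum.cong refl) (auto simp: V_def power_divide)
      also have "\<dots> = t k / (t k)\<^sup>2" by (simp add: t_def sum_divide_distrib)
      also have "\<dots> = 1 / t k" using \<open>t k > 0\<close> by (simp add: power2_eq_square)
      finally show "(\<Sum>j<n. (V j k)\<^sup>2) * (y k)\<^sup>2 = (y k)\<^sup>2 / t k" by simp
    qed
    finally have xx: "(\<Sum>j<n. (x j)\<^sup>2) = (\<Sum>k<r. (y k)\<^sup>2 / t k)" .
    define X where "X = (\<Sum>j<n. (x j)\<^sup>2)"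
    obtain k0 where k0: "k0 < r" "y k0 \<noteq> 0" using y by blast
    have tpos: "t k > 0" if "k < r" for k using t[OF that] T(1) by simp
    have pos: "0 < X" unfolding xx X_def
      by (rule sum_pos2[of _ k0]) (use k0 tpos in \<open>auto intro!: divide_pos_pos divide_nonneg_pos\<close>)
    have "T * X \<le> (\<Sum>k<r. (y k)\<^sup>2)"
      unfolding xx X_def sum_distrib_left
    proof (rule sum_mono)
      fix k assume "k \<in> {..<r}"
      thus "T * ((y k)\<^sup>2 / t k) \<le> (y k)\<^sup>2"
        using t[of k] tpos[of k] by (simp add: field_simps mult_right_mono)
    qed
    hence "\<kappa> * (T * X) \<le> \<kappa> * (\<Sum>k<r. (y k)\<^sup>2)" using \<kappa>(1) by (intro mult_left_mono) auto
    also have "\<dots> \<le> (\<Sum>i<a. (\<Sum>k<r. p i (f k) * y k)\<^sup>2)" by (rule \<kappa>(2))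
    finally have 1: "\<kappa> * (T * X) \<le> (\<Sum>i<a. (\<Sum>k<r. p i (f k) * y k)\<^sup>2)" .
    have Bx: "(\<Sum>j<n. u i * p (li i) (lj j) * v j * x j) = u i * (\<Sum>k<r. p (li i) (f k) * y k)" for i
    proof -
      have "(\<Sum>j<n. p (li i) (lj j) * v j * x j) = (\<Sum>k<r. (\<Sum>j<n. p (li i) (lj j) * v j * V j k) * y k)"
        unfolding x_def sum_distrib_left sum_distrib_right by (subst sum.swap) (simp add: mult_ac)
      also have "\<dots> = (\<Sum>k<r. p (li i) (f k) * y k)"
      proof (intro sum.cong refl)
        fix k assume "k \<in> {..<r}"
        hence "t k > 0" using tpos by simp
        have "(\<Sum>j<n. p (li i) (lj j) * v j * V j k) = (\<Sum>j<n. p (li i) (f k) * ((if lj j = f k then (v j)\<^sup>2 else 0) / t k))"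
          by (intro sum.cong refl) (auto simp: V_def power2_eq_square)
        also have "\<dots> = p (li i) (f k) * (t k / t k)"
          by (simp only: t_def sum_divide_distrib[symmetric] sum_distrib_left[symmetric])
        finally show "(\<Sum>j<n. p (li i) (lj j) * v j * V j k) * y k = p (li i) (f k) * y k" using \<open>t k > 0\<close> by simp
      qed
      finally show ?thesis by (simp add: sum_distrib_left[symmetric] mult.assoc)
    qed
    have "S * (\<kappa> * (T * X)) \<le> S * (\<Sum>l<a. (\<Sum>k<r. p l (f k) * y k)\<^sup>2)"
      using 1 S(1) by (intro mult_left_mono) auto
    also have "\<dots> \<le>
        (\<Sum>l<a. (\<Sum>i<m. if li i = l then (u i)\<^sup>2 else 0) * (\<Sum>k<r. p l (f k) * y k)\<^sup>2)"
      unfolding sum_distrib_left using S(2) by (intro sum_mono mult_right_mono) auto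
    also have "\<dots> = (\<Sum>i<m. (u i)\<^sup>2 * (\<Sum>k<r. p (li i) (f k) * y k)\<^sup>2)"
      by (rule sum_group_labels[symmetric]) (rule li)
    also have "\<dots> = (\<Sum>i<m. (\<Sum>j<n. u i * p (li i) (lj j) * v j * x j)\<^sup>2)"
      unfolding Bx by (simp add: power_mult_distrib)
    finally have "S * (\<kappa> * (T * X)) \<le> (\<Sum>i<m. (\<Sum>j<n. u i * p (li i) (lj j) * v j * x j)\<^sup>2)" .
    hence "sqrt (S * T * \<kappa> * X) \<le> L2_set (\<lambda>i. \<Sum>j<n. u i * p (li i) (lj j) * v j * x j) {..<m}"
      unfolding L2_set_def by (intro real_sqrt_le_mono) (simp add: mult_ac)
    \<comment> \<open>The structured part is the whole minus the noise. This identity of functions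
      has to hold for all \<open>i\<close>, so the entries of \<open>A\<close>, known only for
      \<open>i < m\<close>, are inserted afterwards.\<close>
    also have "(\<lambda>i. \<Sum>j<n. u i * p (li i) (lj j) * v j * x j)
        = (\<lambda>i. (\<Sum>j<n. (u i * p (li i) (lj j) * v j + w i j) * x j) + - (\<Sum>j<n. w i j * x j))"
      by (rule ext) (simp add: distrib_right sum.distrib)
    also have "L2_set \<dots> {..<m} \<le> L2_set (\<lambda>i. \<Sum>j<n. (u i * p (li i) (lj j) * v j + w i j) * x j) {..<m}
        + L2_set (\<lambda>i. - (\<Sum>j<n. w i j * x j)) {..<m}"
      by (rule L2_set_triangle_ineq)
    also have "L2_set (\<lambda>i. - (\<Sum>j<n. w i j * x j)) {..<m} \<le> \<eta> * sqrt X"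
      unfolding L2_set_def X_def
      using real_sqrt_le_mono[OF bilinear_bound_norm[OF w \<eta>(1), of x]] \<eta>(1) by (simp add: real_sqrt_mult)
    also have "L2_set (\<lambda>i. \<Sum>j<n. (u i * p (li i) (lj j) * v j + w i j) * x j) {..<m}
        = L2_set (\<lambda>i. \<Sum>j<n. A $$ (i, j) * x j) {..<m}"
      by (intro L2_set_cong sum.cong refl) (simp add: A_eq)
    finally have "(\<delta> - \<eta>) * sqrt X \<le> L2_set (\<lambda>i. \<Sum>j<n. A $$ (i, j) * x j) {..<m}"
      by (simp add: \<delta>_def real_sqrt_mult left_diff_distrib)
    hence "((\<delta> - \<eta>) * sqrt X)\<^sup>2 \<le> (L2_set (\<lambda>i. \<Sum>j<n. A $$ (i, j) * x j) {..<m})\<^sup>2"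
      using pos \<eta>(2) by (intro power_mono) (auto simp: \<delta>_def)
    hence "(\<delta> - \<eta>)\<^sup>2 * X \<le> (\<Sum>i<m. (\<Sum>j<n. A $$ (i, j) * x j)\<^sup>2)"
      using pos by (simp add: power_mult_distrib L2_set_def sum_nonneg)
    thus "0 < (\<Sum>j<n. (\<Sum>k<r. V j k * y k)\<^sup>2) \<and>
       (\<delta> - \<eta>)\<^sup>2 * (\<Sum>j<n. (\<Sum>k<r. V j k * y k)\<^sup>2)
       \<le> (\<Sum>i<m. (\<Sum>j<n. A $$ (i, j) * (\<Sum>k<r. V j k * y k))\<^sup>2)"
      using pos unfolding X_def x_def by simp
  qed
qed

text \<open>Every row of the structured part is a combination of the \<open>r\<close> functionals
  \<open>g l (lj j) * v j\<close>, so on their common kernel only the noise \<open>w\<close>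
  acts.\<close>

lemma blocks_singular_values_upper:
  fixes p w :: "nat \<Rightarrow> nat \<Rightarrow> real"
  assumes A: "A \<in> carrier_mat m n"
    and A_eq: "\<And>i j. i < m \<Longrightarrow> j < n \<Longrightarrow> A $$ (i, j) = u i * p (li i) (lj j) * v j + w i j"
    and li: "\<And>i. i < m \<Longrightarrow> li i < a" and lj: "\<And>j. j < n \<Longrightarrow> lj j < b"
    and p: "\<And>i j. i < a \<Longrightarrow> j < b \<Longrightarrow> p i j = (\<Sum>k<r. p i (f k) * g k j)"
    and w: "bilinear_bound m n w \<eta>" and \<eta>: "\<eta> > 0"
    and k: "r \<le> k" "k < m" "k < n"
  shows "singular_values A ! k \<le> \<eta>"
proof (rule singular_values_le[OF A k, of _ "\<lambda>l j. g l (lj j) * v j"])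
  fix x :: "nat \<Rightarrow> real"
  assume 0: "\<And>l. l < r \<Longrightarrow> (\<Sum>j<n. g l (lj j) * v j * x j) = 0"
  have "(\<Sum>j<n. A $$ (i, j) * x j) = (\<Sum>j<n. w i j * x j)" if "i < m" for i
  proof -
    have "(\<Sum>j<n. p (li i) (lj j) * v j * x j) = (\<Sum>j<n. (\<Sum>k<r. p (li i) (f k) * g k (lj j)) * v j * x j)"
      by (intro sum.cong refl) (simp add: p[OF li[OF that] lj, symmetric])
    also have "\<dots> = (\<Sum>k<r. p (li i) (f k) * (\<Sum>j<n. g k (lj j) * v j * x j))"
      unfolding sum_distrib_left sum_distrib_right by (subst sum.swap) (simp add: mult_ac)
    also have "\<dots> = 0" by (simp add: 0)
    finally have "(\<Sum>j<n. u i * p (li i) (lj j) * v j * x j) = 0"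
      by (simp add: mult.assoc sum_distrib_left[symmetric])
    thus ?thesis using that by (simp add: A_eq distrib_right sum.distrib)
  qed
  thus "(\<Sum>i<m. (\<Sum>j<n. A $$ (i, j) * x j)\<^sup>2) \<le> \<eta>\<^sup>2 * (\<Sum>j<n. (x j)\<^sup>2)"
    using bilinear_bound_norm[OF w \<eta>, of x] by simp
qed (use \<eta> in simp)

lemma bilinear_bound_singular_values_le:
  assumes A: "A \<in> carrier_mat m n"
    and w: "bilinear_bound m n (\<lambda>i j. A $$ (i, j)) s" and s: "s > 0"
    and k: "k < m" "k < n"
  shows "singular_values A ! k \<le> s"
  \<comment> \<open>With 0 for \<open>r\<close> the kernel condition is vacuous, and the bound is
    demanded of all vectors.\<close>
  by (rule singular_values_le[OF A _ k, of 0 _ "\<lambda>_ _. 0"]) (use bilinear_bound_norm[OF w s] s in auto)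

section \<open>Sums over block labels\<close>

lemma sum_list_map_replicate_concat:
  "sum_list (map f (concat (map (\<lambda>k. replicate (c k) k) ks))) = (\<Sum>k\<leftarrow>ks. real (c k) * f k)"
  by (induction ks) (simp_all add: sum_list_replicate)

lemma length_block_labels: "length (block_labels ms) = sum_list ms"
  by (simp add: block_labels_def length_concat comp_def map_nth)

lemma block_labels_less: "i < sum_list ms \<Longrightarrow> block_labels ms ! i < length ms"
  using nth_mem[of i "block_labels ms"] length_block_labels[of ms]
  by (auto simp: block_labels_def)

lemma sum_block_labels:
  fixes f :: "nat \<Rightarrow> real"
  shows "(\<Sum>i<sum_list ms. f (block_labels ms ! i)) = (\<Sum>k<length ms. real (ms ! k) * f k)"
proof -
  have "(\<Sum>i<sum_list ms. f (block_labels ms ! i)) = sum_list (map f (block_labels ms))"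
    by (simp add: sum_list_sum_nth length_block_labels atLeast0LessThan)
  also have "\<dots> = (\<Sum>k\<leftarrow>[0..<length ms]. real (ms ! k) * f k)"
    unfolding block_labels_def by (rule sum_list_map_replicate_concat)
  also have "\<dots> = (\<Sum>k<length ms. real (ms ! k) * f k)"
    by (simp add: interv_sum_list_conv_sum_set_nat atLeast0LessThan)
  finally show ?thesis .
qed

lemma sum_block_labels_eq:
  fixes c :: real
  assumes "k < length ms"
  shows "(\<Sum>i<sum_list ms. if block_labels ms ! i = k then c else 0) = real (ms ! k) * c"
proof -
  have "(\<Sum>i<sum_list ms. if block_labels ms ! i = k then c else 0)
      = (\<Sum>l<length ms. real (ms ! l) * (if l = k then c else 0))"
    by (rule sum_block_labels)
  also have "\<dots> = (\<Sum>l<length ms. if l = k then real (ms ! k) * c else 0)"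
    by (intro sum.cong refl) auto
  finally show ?thesis using assms by simp
qed

section \<open>Concentration of Wigner noise\<close>

lemma (in prob_space) wigner_noise_measurable:
  assumes "wigner_noise M K m n W" "i < m" "j < n"
  shows "(\<lambda>\<omega>. W \<omega> $$ (i, j)) \<in> borel_measurable M"
  using assms unfolding wigner_noise_def indep_vars_def by auto

text \<open>The summands are independent, centred and bounded by \<open>K * |c i j|\<close>, so the
  total squared range in Hoeffding's inequality is \<open>4 * K\<^sup>2\<close> times the sum of the
  squared coefficients. Row sums, column sums and bilinear forms of the noise are all
  instances.\<close>

lemma (in prob_space) wigner_noise_Hoeffding:
  fixes c :: "nat \<Rightarrow> nat \<Rightarrow> real"
  assumes W: "wigner_noise M K m n W" and K: "K > 0" and t: "t > 0"
    and S: "S > 0" "(\<Sum>i<m. \<Sum>j<n. (c i j)\<^sup>2) \<le> S"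
  shows "prob {\<omega>\<in>space M. t \<le> \<bar>\<Sum>i<m. \<Sum>j<n. c i j * W \<omega> $$ (i, j)\<bar>} \<le> 2 * exp (- (t\<^sup>2 / (2 * K\<^sup>2 * S)))"
proof -
  define I where "I = {..<m} \<times> {..<n}"
  define X where "X = (\<lambda>ij \<omega>. c (fst ij) (snd ij) * W \<omega> $$ ij)"
  define B where "B = (\<lambda>ij. K * \<bar>c (fst ij) (snd ij)\<bar>)"
  define s where "s = (\<Sum>i<m. \<Sum>j<n. (c i j)\<^sup>2)"
  have sum_I: "(\<Sum>i<m. \<Sum>j<n. f (i, j)) = (\<Sum>ij\<in>I. f ij)" for f :: "nat \<times> nat \<Rightarrow> real"
    unfolding I_def by (simp add: sum.cartesian_product)
  have sum_X: "(\<Sum>i<m. \<Sum>j<n. c i j * W \<omega> $$ (i, j)) = (\<Sum>ij\<in>I. X ij \<omega>)" for \<omega>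
    using sum_I[of "\<lambda>ij. X ij \<omega>"] by (simp add: X_def)
  have "indep_vars (\<lambda>_. borel) (\<lambda>ij \<omega>. W \<omega> $$ ij) I"
    using W unfolding wigner_noise_def I_def by (simp add: case_prod_unfold)
  hence indep: "indep_vars (\<lambda>_. borel) X I"
    unfolding X_def by (rule indep_vars_compose2) auto
  have AE: "AE \<omega> in M. X ij \<omega> \<in> {- B ij..B ij}" if "ij \<in> I" for ij
  proof -
    have "AE \<omega> in M. \<bar>W \<omega> $$ ij\<bar> \<le> K"
      using W that unfolding wigner_noise_def I_def by auto
    thus ?thesis
    proof eventually_elim
      case (elim \<omega>)
      have "\<bar>X ij \<omega>\<bar> \<le> B ij"
        unfolding X_def B_def abs_mult using elim by (subst mult.commute) (auto intro: mult_right_mono)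
      thus ?case by (auto simp: abs_le_iff)
    qed
  qed
  have "expectation (X ij) = 0" if "ij \<in> I" for ij
    using W that unfolding wigner_noise_def I_def X_def by auto
  hence mean: "(\<Sum>ij\<in>I. expectation (X ij)) = 0" by simp
  have "(\<Sum>ij\<in>I. (B ij - - B ij)\<^sup>2) = (\<Sum>i<m. \<Sum>j<n. (B (i, j) - - B (i, j))\<^sup>2)"
    by (rule sum_I[symmetric])
  also have "\<dots> = (\<Sum>i<m. \<Sum>j<n. 4 * K\<^sup>2 * (c i j)\<^sup>2)"
    by (intro sum.cong refl) (simp add: B_def power_mult_distrib)
  finally have s4: "(\<Sum>ij\<in>I. (B ij - - B ij)\<^sup>2) = 4 * K\<^sup>2 * s"
    by (simp add: s_def sum_distrib_left)
  interpret Hoeffding_ineq M I X "\<lambda>ij. - B ij" B 0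
  proof unfold_locales
    show "finite I" by (simp add: I_def)
  qed (use indep AE mean in auto)
  show ?thesis
  \<comment> \<open>Hoeffding's inequality wants a positive total range. If all coefficients vanish,
    the event is empty because \<open>t > 0\<close>.\<close>
  proof (cases "s = 0")
    case True
    have "c i j = 0" if "i < m" "j < n" for i j
    proof -
      have "\<forall>i\<in>{..<m}. (\<Sum>j<n. (c i j)\<^sup>2) = 0"
        using True unfolding s_def by (subst (asm) sum_nonneg_eq_0_iff) (auto intro: sum_nonneg)
      hence "(\<Sum>j<n. (c i j)\<^sup>2) = 0" using that by simp
      thus ?thesis using that by (subst (asm) sum_nonneg_eq_0_iff) auto
    qed
    hence "{\<omega>\<in>space M. t \<le> \<bar>\<Sum>i<m. \<Sum>j<n. c i j * W \<omega> $$ (i, j)\<bar>} = {}" using t by auto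
    thus ?thesis by (simp del: Collect_empty_eq)
  next
    case False
    moreover have "s \<ge> 0" unfolding s_def by (intro sum_nonneg) auto
    ultimately have s: "s > 0" by simp
    have "prob {\<omega>\<in>space M. \<bar>(\<Sum>ij\<in>I. X ij \<omega>) - 0\<bar> \<ge> t} \<le> 2 * exp (- 2 * t\<^sup>2 / (\<Sum>ij\<in>I. (B ij - - B ij)\<^sup>2))"
    proof (rule Hoeffding_ineq_abs_ge)
      show "0 \<le> t" using t by simp
      show "0 < (\<Sum>ij\<in>I. (B ij - - B ij)\<^sup>2)" unfolding s4 using s K by simp
    qed
    also have "- 2 * t\<^sup>2 / (\<Sum>ij\<in>I. (B ij - - B ij)\<^sup>2) = - (t\<^sup>2 / (2 * K\<^sup>2 * s))"
      unfolding s4 by simp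
    also have "2 * exp \<dots> \<le> 2 * exp (- (t\<^sup>2 / (2 * K\<^sup>2 * S)))"
      using s S K by (auto simp: s_def intro!: divide_left_mono mult_left_mono)
    finally show ?thesis by (simp add: sum_X)
  qed
qed

section \<open>A finite net of the unit ball\<close>

text \<open>The points of mesh \<open>1 / L\<close> in the Euclidean unit ball. Extensionality pins
  the values at indices from \<open>n\<close> on, which keeps the set finite.\<close>

definition grid :: "nat \<Rightarrow> nat \<Rightarrow> (nat \<Rightarrow> real) set" where
  "grid L n = {x \<in> (\<lambda>k i. real_of_int (k i) / real L) ` ({..<n} \<rightarrow>\<^sub>E {- int L..int L}). (\<Sum>i<n. (x i)\<^sup>2) \<le> 1}"

lemma finite_grid: "finite (grid L n)"
  and card_grid_le: "card (grid L n) \<le> (2 * L + 1) ^ n"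
proof -
  define E where "E = {..<n} \<rightarrow>\<^sub>E {- int L..int L}"
  define h :: "(nat \<Rightarrow> int) \<Rightarrow> nat \<Rightarrow> real" where "h = (\<lambda>k i. real_of_int (k i) / real L)"
  have "finite E" unfolding E_def by (rule finite_PiE) simp_all
  have "card {- int L..int L} = nat (2 * int L + 1)" by simp
  also have "\<dots> = 2 * L + 1" by linarith
  finally have "card {- int L..int L} = 2 * L + 1" .
  moreover have "card E = (\<Prod>i\<in>{..<n}. card {- int L..int L})"
    unfolding E_def by (rule card_PiE[OF finite_lessThan])
  ultimately have "card E = (2 * L + 1) ^ n" by (simp only: prod_constant card_lessThan)
  note E = \<open>finite E\<close> this
  have sub: "grid L n \<subseteq> h ` E" unfolding grid_def E_def h_def by blast
  have fin: "finite (h ` E)" using E(1) by (rule finite_imageI)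
  show "finite (grid L n)" using sub fin by (rule finite_subset)
  have "card (grid L n) \<le> card (h ` E)" using fin sub by (rule card_mono)
  also have "\<dots> \<le> card E" using E(1) by (rule card_image_le)
  finally show "card (grid L n) \<le> (2 * L + 1) ^ n" unfolding E(2) .
qed

text \<open>Each coordinate is rounded towards zero, so absolute values do not grow and the rounded
  point stays in the unit ball.\<close>

lemma round_to_grid:
  assumes L: "L > 0" and x: "(\<Sum>i<n. (x i)\<^sup>2) \<le> (1 :: real)"
  shows "\<exists>z\<in>grid L n. \<forall>i<n. \<bar>z i\<bar> \<le> 1 \<and> \<bar>x i - z i\<bar> \<le> 1 / real L"
proof -
  define q where "q = (\<lambda>s :: real. if s \<ge> 0 then \<lfloor>s\<rfloor> else \<lceil>s\<rceil>)"
  have q: "\<bar>real_of_int (q s)\<bar> \<le> \<bar>s\<bar>" "\<bar>s - real_of_int (q s)\<bar> \<le> 1" for s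
    unfolding q_def by (auto; linarith)+
  have x1: "\<bar>x i\<bar> \<le> 1" if "i < n" for i
  proof -
    have "(x i)\<^sup>2 \<le> (\<Sum>i<n. (x i)\<^sup>2)" using that by (intro member_le_sum) auto
    hence "(x i)\<^sup>2 \<le> 1" using x by linarith
    thus ?thesis by (simp add: abs_square_le_1)
  qed
  define k where "k = restrict (\<lambda>i. q (real L * x i)) {..<n}"
  define z where "z = (\<lambda>i. real_of_int (k i) / real L)"
  have zx: "\<bar>z i\<bar> \<le> \<bar>x i\<bar>" if "i < n" for i
    using q(1)[of "real L * x i"] L that by (simp add: z_def k_def abs_mult field_simps)
  have "\<bar>k i\<bar> \<le> int L" if "i < n" for i
  proof -
    have "\<bar>real_of_int (k i)\<bar> \<le> \<bar>real L * x i\<bar>" using q(1)[of "real L * x i"] that by (simp add: k_def)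
    also have "\<dots> \<le> real L * 1" unfolding abs_mult using x1[OF that] by (intro mult_mono) auto
    finally show ?thesis by linarith
  qed
  hence "k \<in> {..<n} \<rightarrow>\<^sub>E {- int L..int L}"
    unfolding k_def by (auto simp: abs_le_iff)
      (metis abs_le_iff minus_le_iff neg_le_iff_le)+
  moreover have "(\<Sum>i<n. (z i)\<^sup>2) \<le> 1"
    using x by (rule order_trans[rotated]) (intro sum_mono, simp add: abs_le_square_iff[symmetric] zx)
  ultimately have "z \<in> grid L n" unfolding grid_def z_def by blast
  moreover have "\<bar>x i - z i\<bar> \<le> 1 / real L" if "i < n" for i
  proof -
    have "x i - z i = (real L * x i - real_of_int (q (real L * x i))) / real L"
      using L that by (simp add: z_def k_def field_simps)
    thus ?thesis using q(2)[of "real L * x i"] L by (simp add: divide_right_mono)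
  qed
  ultimately show ?thesis using zx x1 by (meson order_trans)
qed

text \<open>The entries of \<open>w\<close> are bounded, so a mesh of \<open>1 / (m n)\<close> makes the discretization error a
  constant; the price, a factor \<open>ln (m n)\<close> in the exponent of the union bound, is harmless.\<close>

lemma grid_imp_bilinear_bound:
  fixes w :: "nat \<Rightarrow> nat \<Rightarrow> real"
  assumes w: "\<And>i j. i < m \<Longrightarrow> j < n \<Longrightarrow> \<bar>w i j\<bar> \<le> K" and K: "K > 0"
    and L: "0 < L" "m * n \<le> L" and t: "t \<ge> 0"
    and grid: "\<And>y x. y \<in> grid L m \<Longrightarrow> x \<in> grid L n \<Longrightarrow> \<bar>\<Sum>i<m. \<Sum>j<n. y i * x j * w i j\<bar> < t"
  shows "(\<Sum>i<m. \<Sum>j<n. w i j * (y i * x j)) \<le> (t + 2 * K) * sqrt (\<Sum>i<m. (y i)\<^sup>2) * sqrt (\<Sum>j<n. (x j)\<^sup>2)"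
proof -
  have unit: "(\<Sum>i<m. \<Sum>j<n. w i j * (y i * x j)) \<le> t + 2 * K"
    if y: "(\<Sum>i<m. (y i)\<^sup>2) \<le> 1" and x: "(\<Sum>j<n. (x j)\<^sup>2) \<le> 1" for x y
  proof -
    obtain y' where y': "y' \<in> grid L m" "\<And>i. i < m \<Longrightarrow> \<bar>y' i\<bar> \<le> 1" "\<And>i. i < m \<Longrightarrow> \<bar>y i - y' i\<bar> \<le> 1 / real L"
      using round_to_grid[OF L(1) y] by blast
    obtain x' where x': "x' \<in> grid L n" "\<And>i. i < n \<Longrightarrow> \<bar>x' i\<bar> \<le> 1" "\<And>i. i < n \<Longrightarrow> \<bar>x i - x' i\<bar> \<le> 1 / real L"
      using round_to_grid[OF L(1) x] by blast
    have y1: "\<bar>y i\<bar> \<le> 1" if "i < m" for i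
    proof -
      have "(y i)\<^sup>2 \<le> (\<Sum>i<m. (y i)\<^sup>2)" using that by (intro member_le_sum) auto
      hence "(y i)\<^sup>2 \<le> 1" using y by linarith
      thus ?thesis by (simp add: abs_square_le_1)
    qed
    \<comment> \<open>Replacing first \<open>x\<close> and then \<open>y\<close> by its grid point
      changes each summand by at most \<open>2 * K / L\<close>, and there are
      \<open>m * n \<le> L\<close> summands.\<close>
    have "(\<Sum>i<m. \<Sum>j<n. w i j * (y i * x j)) - (\<Sum>i<m. \<Sum>j<n. y' i * x' j * w i j)
        = (\<Sum>i<m. \<Sum>j<n. w i j * (y i * (x j - x' j) + (y i - y' i) * x' j))"
      unfolding sum_subtractf[symmetric] by (intro sum.cong refl) (simp add: algebra_simps)
    also have "\<dots> \<le> (\<Sum>i<m. \<Sum>j<n. K * (2 / real L))"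
    proof (intro sum_mono)
      fix i j assume ij: "i \<in> {..<m}" "j \<in> {..<n}"
      have "\<bar>y i * (x j - x' j)\<bar> \<le> 1 * (1 / real L)"
        unfolding abs_mult using ij y1 x'(3) by (intro mult_mono) auto
      moreover have "\<bar>(y i - y' i) * x' j\<bar> \<le> (1 / real L) * 1"
        unfolding abs_mult using ij x'(2) y'(3) by (intro mult_mono) auto
      ultimately have *: "\<bar>y i * (x j - x' j) + (y i - y' i) * x' j\<bar> \<le> 2 / real L" by linarith
      have "\<bar>w i j * (y i * (x j - x' j) + (y i - y' i) * x' j)\<bar> \<le> K * (2 / real L)"
        unfolding abs_mult using ij w K * by (intro mult_mono) auto
      thus "w i j * (y i * (x j - x' j) + (y i - y' i) * x' j) \<le> K * (2 / real L)" by linarith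
    qed
    also have "\<dots> = 2 * K * (real (m * n) / real L)" by simp
    also have "\<dots> \<le> 2 * K * 1" using L K of_nat_mono[OF L(2), where 'a=real] by (intro mult_left_mono) auto
    finally show ?thesis using grid[OF y'(1) x'(1)] by linarith
  qed
  define X where "X = sqrt (\<Sum>j<n. (x j)\<^sup>2)"
  define Y where "Y = sqrt (\<Sum>i<m. (y i)\<^sup>2)"
  have XY: "X \<ge> 0" "Y \<ge> 0" "X\<^sup>2 = (\<Sum>j<n. (x j)\<^sup>2)" "Y\<^sup>2 = (\<Sum>i<m. (y i)\<^sup>2)"
    unfolding X_def Y_def by (simp_all add: sum_nonneg)
  show ?thesis
  \<comment> \<open>Both sides are homogeneous in \<open>x\<close> and in \<open>y\<close>, so
    nonzero vectors can be normalized; if one norm is 0, the form vanishes.\<close>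
  proof (cases "X = 0 \<or> Y = 0")
    case True
    hence "(\<forall>j<n. x j = 0) \<or> (\<forall>i<m. y i = 0)"
      unfolding X_def Y_def by (auto simp: sum_nonneg_eq_0_iff)
    hence "(\<Sum>i<m. \<Sum>j<n. w i j * (y i * x j)) = 0" by (auto intro!: sum.neutral)
    thus ?thesis using t K by (simp add: sum_nonneg)
  next
    case False
    hence pos: "X > 0" "Y > 0" using XY by auto
    have "(\<Sum>i<m. \<Sum>j<n. w i j * (y i / Y * (x j / X))) \<le> t + 2 * K"
      by (rule unit) (use pos XY(3,4) in \<open>simp_all add: power_divide sum_divide_distrib[symmetric]\<close>)
    also have "(\<Sum>i<m. \<Sum>j<n. w i j * (y i / Y * (x j / X))) = (\<Sum>i<m. \<Sum>j<n. w i j * (y i * x j)) / (Y * X)"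
      by (simp add: sum_divide_distrib)
    finally show ?thesis using pos unfolding X_def[symmetric] Y_def[symmetric] by (simp add: field_simps)
  qed
qed

text \<open>A stretched exponential beats every power; beating two powers more than \<open>k\<close>
  leaves a comparison with the series of \<open>1 / \<mu>\<^sup>2\<close>.\<close>

lemma summable_poly_exp_powr:
  fixes \<beta> \<eta> :: real
  assumes "\<beta> > 0" "\<eta> > 0"
  shows "summable (\<lambda>\<mu>. C * real \<mu> ^ k * exp (- (\<beta> * real \<mu> powr \<eta>)))"
proof -
  have "(\<lambda>\<mu>::nat. real \<mu> powr (k + 2) * exp (- (\<beta> * real \<mu> powr \<eta>))) \<longlonglongrightarrow> 0"
    using assms by real_asymp
  hence "eventually (\<lambda>\<mu>::nat. real \<mu> powr (k + 2) * exp (- (\<beta> * real \<mu> powr \<eta>)) < 1) sequentially"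
    by (rule order_tendstoD) simp
  hence "eventually (\<lambda>\<mu>::nat. norm (real \<mu> ^ k * exp (- (\<beta> * real \<mu> powr \<eta>))) \<le> inverse (real \<mu> ^ 2)) sequentially"
    using eventually_gt_at_top[of 0]
  proof eventually_elim
    case (elim \<mu>)
    have "real \<mu> powr (k + 2) = real \<mu> ^ k * real \<mu> ^ 2"
      using elim(2) by (simp add: powr_add powr_realpow)
    thus ?case using elim by (simp add: field_simps)
  qed
  moreover have "summable (\<lambda>\<mu>. inverse (real \<mu> ^ 2))" by (rule inverse_power_summable) simp
  ultimately have "summable (\<lambda>\<mu>. real \<mu> ^ k * exp (- (\<beta> * real \<mu> powr \<eta>)))"
    by (rule summable_comparison_test_ev)
  thus ?thesis using summable_mult[of _ C] by (simp add: mult.assoc)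
qed

section \<open>Union bound and Borel-Cantelli for the noise\<close>

context prob_space
begin

text \<open>The bad event for one size. For the forms the threshold carries
  \<open>sqrt (m + n)\<close>, although their coefficients have norm at most 1: the Hoeffding
  exponent then grows with \<open>m + n\<close> and can outweigh the number of grid points.\<close>

definition large_noise :: "nat \<Rightarrow> nat \<Rightarrow> ('a \<Rightarrow> real mat) \<Rightarrow> real \<Rightarrow> 'a set" where
  "large_noise m n W \<theta> =
     (\<Union>i\<in>{..<m}. {\<omega>\<in>space M. sqrt (real n) * \<theta> \<le> \<bar>\<Sum>j<n. W \<omega> $$ (i, j)\<bar>}) \<union>
     (\<Union>j\<in>{..<n}. {\<omega>\<in>space M. sqrt (real m) * \<theta> \<le> \<bar>\<Sum>i<m. W \<omega> $$ (i, j)\<bar>}) \<union>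
     (\<Union>(y, x)\<in>grid (m * n) m \<times> grid (m * n) n.
       {\<omega>\<in>space M. sqrt (real (m + n)) * \<theta> \<le> \<bar>\<Sum>i<m. \<Sum>j<n. y i * x j * W \<omega> $$ (i, j)\<bar>})"

lemma large_noise_measurable:
  assumes "wigner_noise M K m n W"
  shows "large_noise m n W \<theta> \<in> sets M"
proof -
  note [measurable] = wigner_noise_measurable[OF assms]
  have "(\<lambda>\<omega>. \<Sum>j<n. W \<omega> $$ (i, j)) \<in> borel_measurable M" if "i < m" for i
    using that by (intro borel_measurable_sum) auto
  hence 1: "{\<omega>\<in>space M. c \<le> \<bar>\<Sum>j<n. W \<omega> $$ (i, j)\<bar>} \<in> sets M" if "i < m" for i c
    using that by measurable
  have "(\<lambda>\<omega>. \<Sum>i<m. W \<omega> $$ (i, j)) \<in> borel_measurable M" if "j < n" for j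
    using that by (intro borel_measurable_sum) auto
  hence 2: "{\<omega>\<in>space M. c \<le> \<bar>\<Sum>i<m. W \<omega> $$ (i, j)\<bar>} \<in> sets M" if "j < n" for j c
    using that by measurable
  have "(\<lambda>\<omega>. \<Sum>i<m. \<Sum>j<n. y i * x j * W \<omega> $$ (i, j)) \<in> borel_measurable M" for x y :: "nat \<Rightarrow> real"
    by (intro borel_measurable_sum borel_measurable_times) auto
  hence 3: "{\<omega>\<in>space M. c \<le> \<bar>\<Sum>i<m. \<Sum>j<n. y i * x j * W \<omega> $$ (i, j)\<bar>} \<in> sets M" for x y :: "nat \<Rightarrow> real" and c
    by measurable
  show ?thesis unfolding large_noise_def
  proof (intro sets.Un sets.finite_UN)
    show "finite (grid (m * n) m \<times> grid (m * n) n)" by (simp add: finite_grid)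
  qed (use 1 2 3 in auto)
qed

lemma prob_UN_le:
  assumes "finite I" "\<And>i. i \<in> I \<Longrightarrow> A i \<in> events" "\<And>i. i \<in> I \<Longrightarrow> prob (A i) \<le> q"
    and "card I \<le> N" "q \<ge> 0"
  shows "prob (\<Union>i\<in>I. A i) \<le> real N * q"
proof -
  have "prob (\<Union>i\<in>I. A i) \<le> (\<Sum>i\<in>I. prob (A i))"
    using assms by (intro finite_measure_subadditive_finite) auto
  also have "\<dots> \<le> real (card I) * q" using assms(3) by (intro sum_bounded_above) auto
  also have "\<dots> \<le> real N * q" using assms(4,5) by (intro mult_right_mono) auto
  finally show ?thesis .
qed

text \<open>There are at most \<open>(2 * m * n + 1) ^ (m + n)\<close> pairs of grid points, each
  failing with probability at most \<open>2 * exp (- (m + n) * \<beta>)\<close>. Their share is thus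
  twice an \<open>(m + n)\<close>-th power, of which a single factor is kept.\<close>

lemma prob_large_noise_le:
  assumes W: "wigner_noise M K m n W" and K: "K > 0" and \<theta>: "\<theta> > 0" and mn: "m \<ge> 1" "n \<ge> 1"
  shows "prob (large_noise m n W \<theta>) \<le> 10 * (real m * real n) * exp (- (\<theta>\<^sup>2 / (2 * K\<^sup>2)))"
proof -
  define \<beta> where "\<beta> = \<theta>\<^sup>2 / (2 * K\<^sup>2)"
  note [measurable] = wigner_noise_measurable[OF W]
  define A where "A = (\<lambda>i. {\<omega>\<in>space M. sqrt (real n) * \<theta> \<le> \<bar>\<Sum>j<n. W \<omega> $$ (i, j)\<bar>})"
  define B where "B = (\<lambda>j. {\<omega>\<in>space M. sqrt (real m) * \<theta> \<le> \<bar>\<Sum>i<m. W \<omega> $$ (i, j)\<bar>})"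
  define C where "C = (\<lambda>(y, x). {\<omega>\<in>space M. sqrt (real (m + n)) * \<theta> \<le> \<bar>\<Sum>i<m. \<Sum>j<n. y i * x j * W \<omega> $$ (i, j)\<bar>})"
  define G where "G = grid (m * n) m \<times> grid (m * n) n"
  have A_meas: "A i \<in> events" if "i < m" for i
  proof -
    have "(\<lambda>\<omega>. \<Sum>j<n. W \<omega> $$ (i, j)) \<in> borel_measurable M"
      using that by (intro borel_measurable_sum) auto
    thus ?thesis unfolding A_def by measurable
  qed
  have B_meas: "B j \<in> events" if "j < n" for j
  proof -
    have "(\<lambda>\<omega>. \<Sum>i<m. W \<omega> $$ (i, j)) \<in> borel_measurable M"
      using that by (intro borel_measurable_sum) auto
    thus ?thesis unfolding B_def by measurable
  qed
  have C_meas: "C p \<in> events" for p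
  proof -
    have "(\<lambda>\<omega>. \<Sum>i<m. \<Sum>j<n. fst p i * snd p j * W \<omega> $$ (i, j)) \<in> borel_measurable M"
      by (intro borel_measurable_sum borel_measurable_times) auto
    thus ?thesis unfolding C_def case_prod_unfold by measurable
  qed
  have "prob (A i) \<le> 2 * exp (- \<beta>)" if i: "i < m" for i
  proof -
    \<comment> \<open>The coefficients are the indicator of row \<open>i\<close>, and their squares
      sum to \<open>n\<close>.\<close>
    have "(\<Sum>i'<m. \<Sum>j<n. (if i' = i then 1 else 0) * W \<omega> $$ (i', j)) = (\<Sum>j<n. W \<omega> $$ (i, j))" for \<omega>
    proof -
      have "(\<Sum>i'<m. \<Sum>j<n. (if i' = i then 1 else 0) * W \<omega> $$ (i', j))
          = (\<Sum>i'<m. if i' = i then \<Sum>j<n. W \<omega> $$ (i, j) else 0)"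
        by (rule sum.cong[OF refl]) simp
      thus ?thesis using i by simp
    qed
    moreover have "(\<Sum>i'<m. \<Sum>j<n. (if i' = i then 1 else 0 :: real)\<^sup>2) \<le> real n"
    proof -
      have "(\<Sum>i'<m. \<Sum>j<n. (if i' = i then 1 else 0 :: real)\<^sup>2) = (\<Sum>i'<m. if i' = i then real n else 0)"
        by (rule sum.cong[OF refl]) simp
      thus ?thesis using i by simp
    qed
    ultimately have "prob (A i) \<le> 2 * exp (- ((sqrt (real n) * \<theta>)\<^sup>2 / (2 * K\<^sup>2 * real n)))"
      using wigner_noise_Hoeffding[OF W K, of "sqrt (real n) * \<theta>" "real n" "\<lambda>i' j. if i' = i then 1 else 0"] mn \<theta>
      by (simp add: A_def)
    also have "(sqrt (real n) * \<theta>)\<^sup>2 / (2 * K\<^sup>2 * real n) = \<beta>"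
      using mn by (simp add: \<beta>_def power_mult_distrib)
    finally show ?thesis .
  qed
  hence 1: "prob (\<Union>i\<in>{..<m}. A i) \<le> real m * (2 * exp (- \<beta>))"
    using A_meas by (intro prob_UN_le) auto
  have "prob (B j) \<le> 2 * exp (- \<beta>)" if j: "j < n" for j
  proof -
    have "(\<Sum>i<m. \<Sum>j'<n. (if j' = j then 1 else 0) * W \<omega> $$ (i, j')) = (\<Sum>i<m. W \<omega> $$ (i, j))" for \<omega>
    proof (rule sum.cong[OF refl])
      fix i
      have "(\<Sum>j'<n. (if j' = j then 1 else 0) * W \<omega> $$ (i, j')) = (\<Sum>j'<n. if j' = j then W \<omega> $$ (i, j) else 0)"
        by (rule sum.cong[OF refl]) simp
      thus "(\<Sum>j'<n. (if j' = j then 1 else 0) * W \<omega> $$ (i, j')) = W \<omega> $$ (i, j)" using j by simp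
    qed
    moreover have "(\<Sum>i<m. \<Sum>j'<n. (if j' = j then 1 else 0 :: real)\<^sup>2) \<le> real m"
    proof -
      have "(\<Sum>j'<n. (if j' = j then 1 else 0 :: real)\<^sup>2) = (\<Sum>j'<n. if j' = j then 1 else 0)"
        by (rule sum.cong[OF refl]) simp
      thus ?thesis using j by simp
    qed
    ultimately have "prob (B j) \<le> 2 * exp (- ((sqrt (real m) * \<theta>)\<^sup>2 / (2 * K\<^sup>2 * real m)))"
      using wigner_noise_Hoeffding[OF W K, of "sqrt (real m) * \<theta>" "real m" "\<lambda>i j'. if j' = j then 1 else 0"] mn \<theta>
      by (simp add: B_def)
    also have "(sqrt (real m) * \<theta>)\<^sup>2 / (2 * K\<^sup>2 * real m) = \<beta>"
      using mn by (simp add: \<beta>_def power_mult_distrib)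
    finally show ?thesis .
  qed
  hence 2: "prob (\<Union>j\<in>{..<n}. B j) \<le> real n * (2 * exp (- \<beta>))"
    using B_meas by (intro prob_UN_le) auto
  have "prob (C p) \<le> 2 * exp (- (real (m + n) * \<beta>))" if "p \<in> G" for p
  proof -
    obtain y x where p: "p = (y, x)" by (cases p)
    have yx: "(\<Sum>i<m. (y i)\<^sup>2) \<le> 1" "(\<Sum>j<n. (x j)\<^sup>2) \<le> 1"
      using that unfolding p G_def grid_def by auto
    have "(\<Sum>i<m. \<Sum>j<n. (y i * x j)\<^sup>2) = (\<Sum>i<m. (y i)\<^sup>2) * (\<Sum>j<n. (x j)\<^sup>2)"
      by (simp add: sum_product power_mult_distrib)
    also have "\<dots> \<le> 1" using yx by (intro mult_le_one) (auto intro: sum_nonneg)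
    finally have "prob (C p) \<le> 2 * exp (- ((sqrt (real (m + n)) * \<theta>)\<^sup>2 / (2 * K\<^sup>2 * 1)))"
      using wigner_noise_Hoeffding[OF W K, of "sqrt (real (m + n)) * \<theta>" 1 "\<lambda>i j. y i * x j"] mn \<theta>
      unfolding p C_def by simp
    also have "(sqrt (real (m + n)) * \<theta>)\<^sup>2 / (2 * K\<^sup>2 * 1) = real (m + n) * \<beta>"
      by (simp add: \<beta>_def power_mult_distrib)
    finally show ?thesis .
  qed
  moreover have "card G \<le> (2 * (m * n) + 1) ^ (m + n)"
    unfolding G_def card_cartesian_product power_add by (intro mult_le_mono card_grid_le)
  moreover have "finite G" unfolding G_def by (intro finite_cartesian_product finite_grid)
  ultimately have "prob (\<Union>p\<in>G. C p) \<le> real ((2 * (m * n) + 1) ^ (m + n)) * (2 * exp (- (real (m + n) * \<beta>)))"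
    using C_meas by (intro prob_UN_le) auto
  also have "\<dots> = 2 * ((2 * (real m * real n) + 1) * exp (- \<beta>)) ^ (m + n)"
    unfolding power_mult_distrib exp_of_nat_mult[symmetric] by (simp add: mult_ac add_ac)
  finally have C_le: "prob (\<Union>p\<in>G. C p) \<le> 2 * ((2 * (real m * real n) + 1) * exp (- \<beta>)) ^ (m + n)" .
  \<comment> \<open>If the base is at most 1, its power is at most the base; otherwise the claimed
    bound exceeds 1 and is trivial.\<close>
  have 3: "prob (\<Union>p\<in>G. C p) \<le> 2 * ((2 * (real m * real n) + 1) * exp (- \<beta>))"
  proof (cases "(2 * (real m * real n) + 1) * exp (- \<beta>) \<le> 1")
    case True
    have "((2 * (real m * real n) + 1) * exp (- \<beta>)) ^ (m + n) \<le> ((2 * (real m * real n) + 1) * exp (- \<beta>)) ^ 1"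
      using True mn by (intro power_decreasing) auto
    thus ?thesis using C_le by simp
  next
    case False
    have "prob (\<Union>p\<in>G. C p) \<le> 1" by simp
    thus ?thesis using False by linarith
  qed
  have "prob (large_noise m n W \<theta>) = prob ((\<Union>i\<in>{..<m}. A i) \<union> (\<Union>j\<in>{..<n}. B j) \<union> (\<Union>p\<in>G. C p))"
    unfolding large_noise_def A_def B_def C_def G_def ..
  also have "\<dots> \<le> prob (\<Union>i\<in>{..<m}. A i) + prob (\<Union>j\<in>{..<n}. B j) + prob (\<Union>p\<in>G. C p)"
  proof -
    have ev: "(\<Union>i\<in>{..<m}. A i) \<in> events" "(\<Union>j\<in>{..<n}. B j) \<in> events" "(\<Union>p\<in>G. C p) \<in> events"
      using A_meas B_meas C_meas \<open>finite G\<close> by auto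
    thus ?thesis
      using measure_Un_le[of "(\<Union>i\<in>{..<m}. A i) \<union> (\<Union>j\<in>{..<n}. B j)" M "\<Union>p\<in>G. C p"]
        measure_Un_le[of "\<Union>i\<in>{..<m}. A i" M "\<Union>j\<in>{..<n}. B j"] by auto
  qed
  also have "\<dots> \<le> (2 * real m + 2 * real n + 4 * (real m * real n) + 2) * exp (- \<beta>)"
    using 1 2 3 by (simp add: algebra_simps)
  also have "\<dots> \<le> 10 * (real m * real n) * exp (- \<beta>)"
  proof (rule mult_right_mono)
    have "0 \<le> (real m - 1) * (real n - 1)" using mn by simp
    moreover have "real m * 1 \<le> real m * real n" "1 * real n \<le> real m * real n"
      using mn by (auto intro: mult_left_mono mult_right_mono)
    ultimately show "2 * real m + 2 * real n + 4 * (real m * real n) + 2 \<le> 10 * (real m * real n)"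
      using mn by (simp add: algebra_simps)
  qed simp
  finally show ?thesis unfolding \<beta>_def .
qed

text \<open>All sizes up to \<open>\<mu> ^ H\<close> are merged into one bad event
  \<open>E \<mu>\<close>, whose probability is a power of \<open>\<mu>\<close> times a stretched
  exponential, hence summable. This direction of Borel-Cantelli asks for no independence, so
  matrices of different sizes may be coupled in any way.\<close>

lemma wigner_noise_eventually_small:
  assumes W: "\<And>m n. wigner_noise M K m n (W m n)" and K: "K > 0" and \<eta>: "\<eta> > 0"
  shows "AE \<omega> in M. \<exists>\<mu>0. \<forall>\<mu>\<ge>\<mu>0. \<forall>m n. 1 \<le> m \<and> m \<le> \<mu> ^ H \<and> 1 \<le> n \<and> n \<le> \<mu> ^ H \<longrightarrow>
     (\<forall>i<m. \<bar>\<Sum>j<n. W m n \<omega> $$ (i, j)\<bar> < sqrt (real n) * real \<mu> powr \<eta>) \<and>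
     (\<forall>j<n. \<bar>\<Sum>i<m. W m n \<omega> $$ (i, j)\<bar> < sqrt (real m) * real \<mu> powr \<eta>) \<and>
     (\<forall>x y. (\<Sum>i<m. \<Sum>j<n. W m n \<omega> $$ (i, j) * (y i * x j))
        \<le> (sqrt (real (m + n)) * real \<mu> powr \<eta> + 2 * K) * sqrt (\<Sum>i<m. (y i)\<^sup>2) * sqrt (\<Sum>j<n. (x j)\<^sup>2))"
proof -
  define \<beta> where "\<beta> = 1 / (2 * K\<^sup>2)"
  define I where "I = (\<lambda>\<mu>::nat. {1..\<mu> ^ H} \<times> {1..\<mu> ^ H})"
  define E where "E = (\<lambda>\<mu>. \<Union>(m, n)\<in>I \<mu>. large_noise m n (W m n) (real \<mu> powr \<eta>))"
  have E_meas: "E \<mu> \<in> events" for \<mu>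
    unfolding E_def I_def by (intro sets.finite_UN) (auto intro: large_noise_measurable[OF W])
  have E_prob: "prob (E \<mu>) \<le> 10 * real \<mu> ^ (4 * H) * exp (- (\<beta> * real \<mu> powr (2 * \<eta>)))" if "\<mu> > 0" for \<mu>
  proof -
    \<comment> \<open>There are \<open>\<mu> ^ (2 * H)\<close> pairs of sizes, and
      \<open>m * n\<close> is at most \<open>\<mu> ^ (2 * H)\<close> for each of them; hence the
      exponent \<open>4 * H\<close>.\<close>
    have "prob (E \<mu>) \<le> real (\<mu> ^ H * \<mu> ^ H) * (10 * real \<mu> ^ (2 * H) * exp (- (\<beta> * real \<mu> powr (2 * \<eta>))))"
      unfolding E_def
    proof (rule prob_UN_le)
      show "finite (I \<mu>)" "card (I \<mu>) \<le> \<mu> ^ H * \<mu> ^ H" by (simp_all add: I_def card_cartesian_product)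
      fix mn assume mn: "mn \<in> I \<mu>"
      obtain m n where [simp]: "mn = (m, n)" by (cases mn)
      have le: "1 \<le> m" "m \<le> \<mu> ^ H" "1 \<le> n" "n \<le> \<mu> ^ H" using mn by (auto simp: I_def)
      show "(case mn of (m, n) \<Rightarrow> large_noise m n (W m n) (real \<mu> powr \<eta>)) \<in> events"
        by (simp add: large_noise_measurable[OF W])
      have "real m * real n \<le> real (\<mu> ^ H) * real (\<mu> ^ H)"
        using le by (intro mult_mono of_nat_mono) auto
      hence *: "real m * real n \<le> real \<mu> ^ (2 * H)" by (simp add: mult_2 power_add)
      have "prob (large_noise m n (W m n) (real \<mu> powr \<eta>))
          \<le> 10 * (real m * real n) * exp (- ((real \<mu> powr \<eta>)\<^sup>2 / (2 * K\<^sup>2)))"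
        using that le by (intro prob_large_noise_le W K) auto
      also have "(real \<mu> powr \<eta>)\<^sup>2 / (2 * K\<^sup>2) = \<beta> * real \<mu> powr (2 * \<eta>)"
        by (simp add: \<beta>_def power2_eq_square powr_add[symmetric])
      also have "10 * (real m * real n) * exp (- (\<beta> * real \<mu> powr (2 * \<eta>)))
          \<le> 10 * real \<mu> ^ (2 * H) * exp (- (\<beta> * real \<mu> powr (2 * \<eta>)))"
        using * by (intro mult_right_mono mult_left_mono) auto
      finally show "prob (case mn of (m, n) \<Rightarrow> large_noise m n (W m n) (real \<mu> powr \<eta>))
          \<le> 10 * real \<mu> ^ (2 * H) * exp (- (\<beta> * real \<mu> powr (2 * \<eta>)))" by simp
    qed simp
    also have "\<dots> = 10 * real \<mu> ^ (4 * H) * exp (- (\<beta> * real \<mu> powr (2 * \<eta>)))"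
      by (simp add: power_add[symmetric] mult_ac)
    finally show ?thesis .
  qed
  have "summable (\<lambda>\<mu>. 10 * real \<mu> ^ (4 * H) * exp (- (\<beta> * real \<mu> powr (2 * \<eta>))))"
    using K \<eta> by (intro summable_poly_exp_powr) (auto simp: \<beta>_def)
  hence "summable (\<lambda>\<mu>. prob (E \<mu>))"
  proof (rule summable_comparison_test_ev[rotated])
    show "eventually (\<lambda>\<mu>. norm (prob (E \<mu>)) \<le> 10 * real \<mu> ^ (4 * H) * exp (- (\<beta> * real \<mu> powr (2 * \<eta>)))) sequentially"
      using eventually_gt_at_top[of 0] by eventually_elim (simp add: E_prob)
  qed
  hence "AE \<omega> in M. eventually (\<lambda>\<mu>. \<omega> \<in> space M - E \<mu>) sequentially"
    using E_meas by (intro borel_cantelli_AE1) (auto simp: emeasure_eq_measure)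
  \<comment> \<open>A countable intersection makes the bound \<open>K\<close> hold for all entries
    and sizes at once; the passage from grid points to arbitrary vectors uses it pointwise.\<close>
  moreover have "AE \<omega> in M. \<forall>m n i j. i < m \<longrightarrow> j < n \<longrightarrow> \<bar>W m n \<omega> $$ (i, j)\<bar> \<le> K"
    unfolding AE_all_countable
  proof (intro allI)
    fix m n i j :: nat
    show "AE \<omega> in M. i < m \<longrightarrow> j < n \<longrightarrow> \<bar>W m n \<omega> $$ (i, j)\<bar> \<le> K"
      using W[of m n] unfolding wigner_noise_def by (cases "i < m \<and> j < n") auto
  qed
  ultimately show ?thesis
  proof eventually_elim
    case (elim \<omega>)
    then obtain \<mu>0 where \<mu>0: "\<And>\<mu>. \<mu> \<ge> \<mu>0 \<Longrightarrow> \<omega> \<in> space M - E \<mu>"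
      unfolding eventually_sequentially by blast
    show ?case
    proof (rule exI[of _ \<mu>0], intro allI impI, elim conjE)
      fix \<mu> m n assume \<mu>: "\<mu>0 \<le> \<mu>" and mn: "1 \<le> m" "m \<le> \<mu> ^ H" "1 \<le> n" "n \<le> \<mu> ^ H"
      have sp: "\<omega> \<in> space M" and "\<omega> \<notin> E \<mu>" using \<mu>0[OF \<mu>] by auto
      hence notin: "\<omega> \<notin> large_noise m n (W m n) (real \<mu> powr \<eta>)"
        using mn unfolding E_def I_def by auto
      have 1: "\<forall>i<m. \<bar>\<Sum>j<n. W m n \<omega> $$ (i, j)\<bar> < sqrt (real n) * real \<mu> powr \<eta>"
        using notin sp unfolding large_noise_def by (auto simp: not_le)
      have 2: "\<forall>j<n. \<bar>\<Sum>i<m. W m n \<omega> $$ (i, j)\<bar> < sqrt (real m) * real \<mu> powr \<eta>"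
        using notin sp unfolding large_noise_def by (auto simp: not_le)
      have 3: "\<bar>\<Sum>i<m. \<Sum>j<n. y i * x j * W m n \<omega> $$ (i, j)\<bar> < sqrt (real (m + n)) * real \<mu> powr \<eta>"
        if "y \<in> grid (m * n) m" "x \<in> grid (m * n) n" for x y
        using notin sp that unfolding large_noise_def by (force simp: not_le)
      have "(\<Sum>i<m. \<Sum>j<n. W m n \<omega> $$ (i, j) * (y i * x j))
        \<le> (sqrt (real (m + n)) * real \<mu> powr \<eta> + 2 * K) * sqrt (\<Sum>i<m. (y i)\<^sup>2) * sqrt (\<Sum>j<n. (x j)\<^sup>2)" for x y
        by (rule grid_imp_bilinear_bound[where L = "m * n"]) (use elim(2) K mn 3 in auto)
      with 1 2 show "(\<forall>i<m. \<bar>\<Sum>j<n. W m n \<omega> $$ (i, j)\<bar> < sqrt (real n) * real \<mu> powr \<eta>) \<and>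
        (\<forall>j<n. \<bar>\<Sum>i<m. W m n \<omega> $$ (i, j)\<bar> < sqrt (real m) * real \<mu> powr \<eta>) \<and>
        (\<forall>x y. (\<Sum>i<m. \<Sum>j<n. W m n \<omega> $$ (i, j) * (y i * x j))
        \<le> (sqrt (real (m + n)) * real \<mu> powr \<eta> + 2 * K) * sqrt (\<Sum>i<m. (y i)\<^sup>2) * sqrt (\<Sum>j<n. (x j)\<^sup>2))"
        by blast
    qed
  qed
qed

end

section \<open>The correspondence transformation\<close>

lemma corr_index:
  assumes "A \<in> carrier_mat m n" "i < m" "j < n"
  shows "corr A $$ (i, j) = row_sum A i powr (- 1/2) * A $$ (i, j) * col_sum A j powr (- 1/2)"
proof -
  have dim: "dim_row A = m" "dim_col A = n" using assms(1) by auto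
  have 1: "mat_diag m (\<lambda>i. row_sum A i powr (- 1/2)) * A
      = Matrix.mat m n (\<lambda>(i, j). row_sum A i powr (- 1/2) * A $$ (i, j))"
    by (rule mat_diag_mult_left[OF assms(1)])
  have "corr A = Matrix.mat m n (\<lambda>(i, j). Matrix.mat m n (\<lambda>(i, j). row_sum A i powr (- 1/2) * A $$ (i, j)) $$ (i, j)
      * col_sum A j powr (- 1/2))"
    unfolding corr_def dim 1 by (rule mat_diag_mult_right) simp
  thus ?thesis using assms(2,3) by simp
qed

lemma corr_carrier:
  assumes A: "A \<in> carrier_mat m n"
  shows "corr A \<in> carrier_mat m n"
proof -
  have "dim_row A = m" "dim_col A = n" using A by auto
  thus ?thesis
    using mult_carrier_mat[OF mult_carrier_mat[OF mat_diag_dim A] mat_diag_dim] by (simp only: corr_def)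
qed

lemma length_le_sum_list: "(\<And>x. x \<in> set xs \<Longrightarrow> 0 < x) \<Longrightarrow> length xs \<le> sum_list (xs :: nat list)"
proof (induction xs)
  case (Cons x xs)
  have "length xs \<le> sum_list xs" "0 < x" using Cons by auto
  thus ?case by simp
qed simp

text \<open>A single block with entry at least \<open>p0\<close> fills at least a fraction
  \<open>d\<close> of the indices, and the other entries are non-negative.\<close>

lemma block_sum_bounds:
  fixes q :: "nat \<Rightarrow> real"
  assumes ns: "length ns = b" "sum_list ns = n" and d: "\<And>y. y \<in> set ns \<Longrightarrow> d * real n \<le> real y"
    and q: "\<And>l. l < b \<Longrightarrow> 0 \<le> q l" "\<And>l. l < b \<Longrightarrow> q l \<le> p1" "l0 < b" "p0 \<le> q l0" and p0: "p0 \<ge> 0"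
  shows "p0 * d * real n \<le> (\<Sum>j<n. q (block_labels ns ! j))" "(\<Sum>j<n. q (block_labels ns ! j)) \<le> p1 * real n"
proof -
  have eq: "(\<Sum>j<n. q (block_labels ns ! j)) = (\<Sum>l<b. real (ns ! l) * q l)"
    using sum_block_labels[of q ns] ns by simp
  have "p0 * d * real n \<le> real (ns ! l0) * q l0"
  proof -
    have "d * real n * p0 \<le> real (ns ! l0) * p0" using d[of "ns ! l0"] q(3) ns p0 by (intro mult_right_mono) auto
    also have "\<dots> \<le> real (ns ! l0) * q l0" using q(4) by (intro mult_left_mono) auto
    finally show ?thesis by (simp add: mult_ac)
  qed
  also have "\<dots> \<le> (\<Sum>l<b. real (ns ! l) * q l)" using q by (intro member_le_sum) auto
  finally show "p0 * d * real n \<le> (\<Sum>j<n. q (block_labels ns ! j))" by (simp add: eq)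
  have "(\<Sum>j<n. q (block_labels ns ! j)) \<le> (\<Sum>j<n. p1)"
    using block_labels_less[of _ ns] ns q(2) by (intro sum_mono) auto
  thus "(\<Sum>j<n. q (block_labels ns ! j)) \<le> p1 * real n" by (simp add: mult.commute)
qed

text \<open>Here \<open>s\<close> is a row or column sum of the blown up matrix and \<open>e\<close>
  its noise. The condition \<open>2 * \<gamma> \<le> \<alpha>\<close> leaves \<open>s + e\<close> at
  least half of \<open>\<alpha> * N\<close>, \<open>4 * \<gamma> \<le> \<alpha> * \<epsilon>\<close>
  makes the noise at most \<open>\<epsilon> / 2\<close> of the perturbed sum, and
  \<open>\<gamma> \<le> 1\<close> turns \<open>p1\<close> into \<open>p1 + 1\<close>.\<close>

lemma perturbed_sum_bounds:
  fixes N :: real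
  assumes N: "N > 0" and s: "\<alpha> * N \<le> s" "s \<le> p1 * N" and e: "\<bar>e\<bar> \<le> \<gamma> * N"
    and \<gamma>: "2 * \<gamma> \<le> \<alpha>" "4 * \<gamma> \<le> \<alpha> * \<epsilon>" "\<gamma> \<le> 1" and \<alpha>: "\<alpha> > 0"
  shows "0 < s + e" "((s + e) powr (- 1/2))\<^sup>2 * s \<le> 1 + \<epsilon> / 2" "((s + e) powr (- 1/2))\<^sup>2 \<le> 2 / (\<alpha> * N)"
    "1 / ((p1 + 1) * N) \<le> ((s + e) powr (- 1/2))\<^sup>2"
proof -
  have "2 * \<gamma> * N \<le> \<alpha> * N" using \<gamma>(1) N by (intro mult_right_mono) auto
  hence lower: "\<alpha> * N / 2 \<le> s + e" using s(1) e by linarith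
  have aN: "\<alpha> * N > 0" using \<alpha> N by simp
  show pos: "0 < s + e" using lower aN by linarith
  have sq: "((s + e) powr (- 1/2))\<^sup>2 = 1 / (s + e)"
  proof -
    have "((s + e) powr (- 1/2))\<^sup>2 = (s + e) powr (- 1/2 + - 1/2)" by (simp only: power2_eq_square powr_add)
    thus ?thesis using pos by (simp add: powr_minus_divide)
  qed
  show "((s + e) powr (- 1/2))\<^sup>2 \<le> 2 / (\<alpha> * N)"
    unfolding sq using lower pos aN by (simp add: field_simps)
  have "\<epsilon> / 2 * (s + e) \<ge> \<epsilon> / 2 * (\<alpha> * N / 2)"
  proof (rule mult_left_mono[OF lower])
    have "\<gamma> * N \<ge> 0" using e by linarith
    hence "\<gamma> \<ge> 0" using N by (simp add: zero_le_mult_iff)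
    hence "\<alpha> * \<epsilon> \<ge> 0" using \<gamma>(2) by linarith
    thus "0 \<le> \<epsilon> / 2" using \<alpha> by (simp add: zero_le_mult_iff)
  qed
  moreover have "4 * \<gamma> * N \<le> \<alpha> * \<epsilon> * N" using \<gamma>(2) N by (intro mult_right_mono) auto
  ultimately have "\<gamma> * N \<le> \<epsilon> / 2 * (s + e)" by (simp add: algebra_simps)
  hence "s \<le> (s + e) + \<epsilon> / 2 * (s + e)" using e by linarith
  hence "s \<le> (1 + \<epsilon> / 2) * (s + e)" by (simp add: distrib_right)
  thus "((s + e) powr (- 1/2))\<^sup>2 * s \<le> 1 + \<epsilon> / 2" unfolding sq using pos by (simp add: field_simps)
  have "\<gamma> * N \<le> 1 * N" using \<gamma>(3) N by (intro mult_right_mono) auto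
  hence "s + e \<le> (p1 + 1) * N" using s(2) e by (simp add: algebra_simps)
  thus "1 / ((p1 + 1) * N) \<le> ((s + e) powr (- 1/2))\<^sup>2" unfolding sq using pos by (intro divide_left_mono) auto
qed

text \<open>The deterministic core, for one matrix whose noise is small: \<open>\<theta>\<close> is
  the noise level per square root of the dimension and \<open>\<gamma>\<close> the relative error.
  Half of \<open>\<epsilon>\<close> pays for the perturbed row and column sums, the other half for
  the norm of the scaled noise.\<close>

lemma corr_singular_values:
  fixes P w :: "real mat"
  assumes P: "P \<in> carrier_mat a b"
    and P_nonneg: "\<And>i j. i < a \<Longrightarrow> j < b \<Longrightarrow> 0 \<le> P $$ (i, j)"
    and p1: "\<And>i j. i < a \<Longrightarrow> j < b \<Longrightarrow> P $$ (i, j) \<le> p1" "p1 \<ge> 0"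
    and p0: "p0 > 0" "\<And>i. i < a \<Longrightarrow> \<exists>j<b. p0 \<le> P $$ (i, j)" "\<And>j. j < b \<Longrightarrow> \<exists>i<a. p0 \<le> P $$ (i, j)"
    and r: "r \<le> a" "r \<le> b" and f: "\<And>k. k < r \<Longrightarrow> f k < b" "inj_on f {..<r}"
    and Pfg: "\<And>i j. i < a \<Longrightarrow> j < b \<Longrightarrow> P $$ (i, j) = (\<Sum>k<r. P $$ (i, f k) * g k j)"
    and \<kappa>: "\<kappa> > 0" "\<And>y. \<kappa> * (\<Sum>k<r. (y k)\<^sup>2) \<le> (\<Sum>i<a. (\<Sum>k<r. P $$ (i, f k) * y k)\<^sup>2)"
    and bs: "block_sizes a m ms" "block_sizes b n ns" and gc: "GC1 c d ms ns" and cd: "0 < c" "0 < d"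
    and mn: "m > 0" "n > 0"
    and w: "w \<in> carrier_mat m n"
    and w_row: "\<And>i. i < m \<Longrightarrow> \<bar>\<Sum>j<n. w $$ (i, j)\<bar> < sqrt (real n) * \<theta>"
    and w_col: "\<And>j. j < n \<Longrightarrow> \<bar>\<Sum>i<m. w $$ (i, j)\<bar> < sqrt (real m) * \<theta>"
    and w_norm: "\<And>x y. (\<Sum>i<m. \<Sum>j<n. w $$ (i, j) * (y i * x j))
        \<le> (sqrt (real (m + n)) * \<theta> + 2 * K) * sqrt (\<Sum>i<m. (y i)\<^sup>2) * sqrt (\<Sum>j<n. (x j)\<^sup>2)"
    and K: "K > 0" and \<theta>: "1 \<le> \<theta>" "\<theta> \<le> \<gamma> * sqrt (real m)" "\<theta> \<le> \<gamma> * sqrt (real n)"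
    and \<gamma>: "8 * (1 + K) * \<gamma> \<le> p0 * min c d * \<epsilon>" "\<gamma> \<le> 1"
    and \<epsilon>: "0 < \<epsilon>" "\<epsilon> \<le> 1" "\<epsilon> \<le> \<delta>" and \<delta>: "\<delta> = sqrt (c * d * \<kappa>) / (p1 + 1)"
  defines "A \<equiv> blown_up P ms ns + w"
  shows "(\<forall>i<m. 0 < row_sum A i) \<and> (\<forall>j<n. 0 < col_sum A j) \<and>
    (\<forall>k<r. singular_values (corr A) ! k \<in> {\<delta> - \<epsilon> .. 1 + \<epsilon>}) \<and>
    (\<forall>k. r \<le> k \<and> k < min m n \<longrightarrow> singular_values (corr A) ! k \<le> \<epsilon>)"
proof -
  have ms: "length ms = a" "sum_list ms = m" "\<And>x. x \<in> set ms \<Longrightarrow> c * real m \<le> real x"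
    using bs(1) gc mn unfolding block_sizes_def GC1_def by (auto simp: field_simps)
  have ns: "length ns = b" "sum_list ns = n" "\<And>x. x \<in> set ns \<Longrightarrow> d * real n \<le> real x"
    using bs(2) gc mn unfolding block_sizes_def GC1_def by (auto simp: field_simps)
  \<comment> \<open>With \<open>r \<le> a\<close> and \<open>r \<le> b\<close> this puts every index
    \<open>k < r\<close> inside the list of singular values.\<close>
  have "a \<le> m" "b \<le> n"
    using length_le_sum_list[of ms] length_le_sum_list[of ns] bs ms ns unfolding block_sizes_def by auto
  define li where "li = (\<lambda>i. block_labels ms ! i)"
  define lj where "lj = (\<lambda>j. block_labels ns ! j)"
  have li: "li i < a" if "i < m" for i using block_labels_less[of i ms] that ms by (simp add: li_def)
  have lj: "lj j < b" if "j < n" for j using block_labels_less[of j ns] that ns by (simp add: lj_def)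
  have A: "A \<in> carrier_mat m n" using w by (simp add: A_def)
  have A_index: "A $$ (i, j) = P $$ (li i, lj j) + w $$ (i, j)" if "i < m" "j < n" for i j
    using that w ms ns by (simp add: A_def blown_up_def li_def lj_def)
  define \<alpha> where "\<alpha> = p0 * min c d"
  have \<alpha>: "\<alpha> > 0" using p0 cd by (simp add: \<alpha>_def)
  have \<gamma>_pos: "\<gamma> > 0"
  proof -
    have "0 < \<gamma> * sqrt (real m)" using \<theta> by linarith
    thus ?thesis by (simp add: zero_less_mult_iff)
  qed
  have "8 * \<gamma> \<le> 8 * (1 + K) * \<gamma>" using K \<gamma>_pos by simp
  hence 8: "8 * \<gamma> \<le> \<alpha> * \<epsilon>" using \<gamma>(1) by (simp add: \<alpha>_def)
  have "\<alpha> * \<epsilon> \<le> \<alpha> * 1" using \<alpha> \<epsilon> by (intro mult_left_mono) auto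
  hence \<gamma>': "2 * \<gamma> \<le> \<alpha>" "4 * \<gamma> \<le> \<alpha> * \<epsilon>" using 8 \<gamma>_pos by linarith+
  define rb where "rb = (\<lambda>i. \<Sum>j<n. P $$ (li i, lj j))"
  define cb where "cb = (\<lambda>j. \<Sum>i<m. P $$ (li i, lj j))"
  define re where "re = (\<lambda>i. \<Sum>j<n. w $$ (i, j))"
  define ce where "ce = (\<lambda>j. \<Sum>i<m. w $$ (i, j))"
  define u where "u = (\<lambda>i. (rb i + re i) powr (- 1/2))"
  define v where "v = (\<lambda>j. (cb j + ce j) powr (- 1/2))"
  have row: "row_sum A i = rb i + re i" if "i < m" for i
    using that A by (simp add: row_sum_def A_index rb_def re_def sum.distrib)
  have col: "col_sum A j = cb j + ce j" if "j < n" for j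
    using that A by (simp add: col_sum_def A_index cb_def ce_def sum.distrib)
  have rbounds: "0 < rb i + re i" "(u i)\<^sup>2 * rb i \<le> 1 + \<epsilon> / 2" "(u i)\<^sup>2 \<le> 2 / (\<alpha> * real n)"
    "1 / ((p1 + 1) * real n) \<le> (u i)\<^sup>2" if i: "i < m" for i
  proof -
    obtain l0 where l0: "l0 < b" "p0 \<le> P $$ (li i, l0)" using p0(2)[OF li[OF i]] by blast
    have "p0 * d * real n \<le> rb i" and ub: "rb i \<le> p1 * real n"
      using block_sum_bounds[OF ns, of "\<lambda>l. P $$ (li i, l)" p1 l0 p0] P_nonneg p1(1) li[OF i] l0 p0(1)
      unfolding rb_def lj_def by auto
    moreover have "\<alpha> * real n \<le> p0 * d * real n"
      unfolding \<alpha>_def using p0(1) by (intro mult_right_mono mult_left_mono) auto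
    ultimately have lb: "\<alpha> * real n \<le> rb i" by linarith
    have "sqrt (real n) * \<theta> \<le> sqrt (real n) * (\<gamma> * sqrt (real n))" using \<theta>(3) by (intro mult_left_mono) auto
    also have "\<dots> = \<gamma> * real n" by simp
    finally have e: "\<bar>re i\<bar> \<le> \<gamma> * real n" using w_row[OF i] unfolding re_def by linarith
    have n: "real n > 0" using mn by simp
    show "0 < rb i + re i" "(u i)\<^sup>2 * rb i \<le> 1 + \<epsilon> / 2" "(u i)\<^sup>2 \<le> 2 / (\<alpha> * real n)"
      "1 / ((p1 + 1) * real n) \<le> (u i)\<^sup>2"
      using perturbed_sum_bounds[OF n lb ub e \<gamma>' \<gamma>(2) \<alpha>] unfolding u_def by auto
  qed
  have cbounds: "0 < cb j + ce j" "(v j)\<^sup>2 * cb j \<le> 1 + \<epsilon> / 2" "(v j)\<^sup>2 \<le> 2 / (\<alpha> * real m)"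
    "1 / ((p1 + 1) * real m) \<le> (v j)\<^sup>2" if j: "j < n" for j
  proof -
    obtain l0 where l0: "l0 < a" "p0 \<le> P $$ (l0, lj j)" using p0(3)[OF lj[OF j]] by blast
    have "p0 * c * real m \<le> cb j" and ub: "cb j \<le> p1 * real m"
      using block_sum_bounds[OF ms, of "\<lambda>l. P $$ (l, lj j)" p1 l0 p0] P_nonneg p1(1) lj[OF j] l0 p0(1)
      unfolding cb_def li_def by auto
    moreover have "\<alpha> * real m \<le> p0 * c * real m"
      unfolding \<alpha>_def using p0(1) by (intro mult_right_mono mult_left_mono) auto
    ultimately have lb: "\<alpha> * real m \<le> cb j" by linarith
    have "sqrt (real m) * \<theta> \<le> sqrt (real m) * (\<gamma> * sqrt (real m))" using \<theta>(2) by (intro mult_left_mono) auto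
    also have "\<dots> = \<gamma> * real m" by simp
    finally have e: "\<bar>ce j\<bar> \<le> \<gamma> * real m" using w_col[OF j] unfolding ce_def by linarith
    have m: "real m > 0" using mn by simp
    show "0 < cb j + ce j" "(v j)\<^sup>2 * cb j \<le> 1 + \<epsilon> / 2" "(v j)\<^sup>2 \<le> 2 / (\<alpha> * real m)"
      "1 / ((p1 + 1) * real m) \<le> (v j)\<^sup>2"
      using perturbed_sum_bounds[OF m lb ub e \<gamma>' \<gamma>(2) \<alpha>] unfolding v_def by auto
  qed
  have corr: "corr A \<in> carrier_mat m n" using A by (rule corr_carrier)
  have corr_eq: "corr A $$ (i, j) = u i * P $$ (li i, lj j) * v j + u i * w $$ (i, j) * v j"
    if "i < m" "j < n" for i j
    using that by (simp add: corr_index[OF A] row col A_index u_def v_def algebra_simps)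
  have B: "bilinear_bound m n (\<lambda>i j. u i * P $$ (li i, lj j) * v j) (1 + \<epsilon> / 2)"
    using rbounds(2) cbounds(2) P_nonneg li lj
    by (intro bilinear_bound_row_col_sums) (auto simp: rb_def cb_def)
  have N: "bilinear_bound m n (\<lambda>i j. u i * w $$ (i, j) * v j) (\<epsilon> / 2)"
  proof (rule bilinear_bound_scale[OF w_norm])
    show "0 \<le> sqrt (real (m + n)) * \<theta> + 2 * K" using \<theta>(1) K by simp
    define M where "M = sqrt (real m) * sqrt (real n)"
    have M: "M > 0" using mn by (simp add: M_def)
    have sq: "sqrt (2 / (\<alpha> * real n) * (2 / (\<alpha> * real m))) = 2 / (\<alpha> * M)"
      using \<alpha> mn by (simp add: M_def real_sqrt_divide real_sqrt_mult)
    have le: "sqrt (real (m + n)) * \<theta> + 2 * K \<le> 2 * (1 + K) * \<gamma> * M"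
    proof -
      have "sqrt (real (m + n)) \<le> sqrt (real m) + sqrt (real n)"
        using sqrt_add_le_add_sqrt[of "real m" "real n"] by simp
      hence "sqrt (real (m + n)) * \<theta> \<le> (sqrt (real m) + sqrt (real n)) * \<theta>" using \<theta>(1) by (intro mult_right_mono) auto
      \<comment> \<open>Each square root is paired with the bound on \<open>\<theta>\<close> by the
        other dimension, so that both terms become \<open>\<gamma> * M\<close>.\<close>
      moreover have "sqrt (real m) * \<theta> \<le> sqrt (real m) * (\<gamma> * sqrt (real n))" "sqrt (real n) * \<theta> \<le> sqrt (real n) * (\<gamma> * sqrt (real m))"
        using \<theta> by (auto intro: mult_left_mono)
      ultimately have 1: "sqrt (real (m + n)) * \<theta> \<le> 2 * \<gamma> * M" by (simp add: M_def algebra_simps)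
      \<comment> \<open>The additive constant \<open>2 * K\<close> is absorbed through \<open>1
        \<le> \<theta>\<^sup>2 \<le> \<gamma>\<^sup>2 * M \<le> \<gamma> * M\<close>.\<close>
      have "1 * 1 \<le> (\<gamma> * sqrt (real m)) * (\<gamma> * sqrt (real n))" using \<theta> by (intro mult_mono) auto
      also have "\<dots> = \<gamma> * (\<gamma> * M)" by (simp add: M_def)
      also have "\<dots> \<le> 1 * (\<gamma> * M)" using \<gamma>(2) \<gamma>_pos M by (intro mult_right_mono) auto
      finally have "2 * K * 1 \<le> 2 * K * (\<gamma> * M)" using K by (intro mult_left_mono) auto
      thus ?thesis using 1 by (simp add: algebra_simps)
    qed
    have "(sqrt (real (m + n)) * \<theta> + 2 * K) * sqrt (2 / (\<alpha> * real n) * (2 / (\<alpha> * real m)))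
        \<le> 2 * (1 + K) * \<gamma> * M * (2 / (\<alpha> * M))"
      unfolding sq using le by (rule mult_right_mono) (use \<alpha> M in simp)
    also have "\<dots> = 4 * (1 + K) * \<gamma> / \<alpha>" using M by simp
    also have "\<dots> \<le> \<epsilon> / 2" using \<gamma>(1) \<alpha> unfolding \<alpha>_def[symmetric] by (simp add: field_simps)
    finally show "(sqrt (real (m + n)) * \<theta> + 2 * K) * sqrt (2 / (\<alpha> * real n) * (2 / (\<alpha> * real m))) \<le> \<epsilon> / 2" .
  qed (use rbounds(3) cbounds(3) \<alpha> in auto)
  have \<delta>_pos: "\<delta> > 0" using \<epsilon> by linarith
  have upper: "singular_values (corr A) ! k \<le> 1 + \<epsilon>" if "k < m" "k < n" for k
  proof -
    have eq: "(\<Sum>i<m. \<Sum>j<n. corr A $$ (i, j) * (y i * x j))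
        = (\<Sum>i<m. \<Sum>j<n. (u i * P $$ (li i, lj j) * v j + u i * w $$ (i, j) * v j) * (y i * x j))" for x y :: "nat \<Rightarrow> real"
      by (intro sum.cong refl) (simp add: corr_eq)
    have "1 + \<epsilon> / 2 + \<epsilon> / 2 = 1 + \<epsilon>" by simp
    hence "bilinear_bound m n (\<lambda>i j. u i * P $$ (li i, lj j) * v j + u i * w $$ (i, j) * v j) (1 + \<epsilon>)"
      using bilinear_bound_add[OF B N] by metis
    hence "bilinear_bound m n (\<lambda>i j. corr A $$ (i, j)) (1 + \<epsilon>)"
      unfolding bilinear_bound_def eq .
    thus ?thesis using \<epsilon> that by (intro bilinear_bound_singular_values_le[OF corr]) auto
  qed
  have lower: "\<delta> - \<epsilon> \<le> singular_values (corr A) ! k" if k: "k < r" for k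
  proof -
    \<comment> \<open>Every row block has at least \<open>c * m\<close> rows, each with squared
      weight at least \<open>1 / ((p1 + 1) * n)\<close>, and symmetrically for columns. The sizes
      cancel in \<open>S * T\<close>, and \<open>sqrt (S * T * \<kappa>)\<close> is exactly
      \<open>\<delta>\<close>.\<close>
    define S where "S = c * real m / ((p1 + 1) * real n)"
    define T where "T = d * real n / ((p1 + 1) * real m)"
    have S: "S > 0" and T: "T > 0" unfolding S_def T_def using cd mn p1(2) by auto
    have S_le: "S \<le> (\<Sum>i<m. if li i = l then (u i)\<^sup>2 else 0)" if "l < a" for l
    proof -
      have "c * real m * (1 / ((p1 + 1) * real n)) \<le> real (ms ! l) * (1 / ((p1 + 1) * real n))"
        using ms(3)[of "ms ! l"] that ms(1) p1(2) by (intro mult_right_mono) auto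
      also have "\<dots> = (\<Sum>i<m. if li i = l then 1 / ((p1 + 1) * real n) else 0)"
        using sum_block_labels_eq[of l ms "1 / ((p1 + 1) * real n)"] that ms by (simp add: li_def)
      also have "\<dots> \<le> (\<Sum>i<m. if li i = l then (u i)\<^sup>2 else 0)" using rbounds(4) by (intro sum_mono) auto
      finally show ?thesis by (simp add: S_def)
    qed
    have T_le: "T \<le> (\<Sum>j<n. if lj j = l then (v j)\<^sup>2 else 0)" if "l < b" for l
    proof -
      have "d * real n * (1 / ((p1 + 1) * real m)) \<le> real (ns ! l) * (1 / ((p1 + 1) * real m))"
        using ns(3)[of "ns ! l"] that ns(1) p1(2) by (intro mult_right_mono) auto
      also have "\<dots> = (\<Sum>j<n. if lj j = l then 1 / ((p1 + 1) * real m) else 0)"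
        using sum_block_labels_eq[of l ns "1 / ((p1 + 1) * real m)"] that ns by (simp add: lj_def)
      also have "\<dots> \<le> (\<Sum>j<n. if lj j = l then (v j)\<^sup>2 else 0)" using cbounds(4) by (intro sum_mono) auto
      finally show ?thesis by (simp add: T_def)
    qed
    have "S * T * \<kappa> = c * d * \<kappa> / (p1 + 1)\<^sup>2" using mn unfolding S_def T_def by (simp add: power2_eq_square)
    hence ST: "sqrt (S * T * \<kappa>) = \<delta>" using p1(2) by (simp add: \<delta> real_sqrt_divide)
    have "sqrt (S * T * \<kappa>) - \<epsilon> / 2 \<le> singular_values (corr A) ! k"
    proof (rule blocks_singular_values_lower[where p = "\<lambda>i j. P $$ (i, j)", OF corr corr_eq li lj f \<kappa> S S_le T T_le N _ _ k])
      show "\<epsilon> / 2 \<le> sqrt (S * T * \<kappa>)" unfolding ST using \<epsilon> by linarith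
    qed (use \<epsilon> k r \<open>a \<le> m\<close> \<open>b \<le> n\<close> in auto)
    thus ?thesis using \<epsilon>(1) unfolding ST by linarith
  qed
  have rest: "singular_values (corr A) ! k \<le> \<epsilon>" if k: "r \<le> k" "k < m" "k < n" for k
  proof -
    have "singular_values (corr A) ! k \<le> \<epsilon> / 2"
      by (rule blocks_singular_values_upper[where p = "\<lambda>i j. P $$ (i, j)", OF corr corr_eq li lj Pfg N _ k])
        (use \<epsilon> in auto)
    thus ?thesis using \<epsilon>(1) by linarith
  qed
  show ?thesis using row col rbounds(1) cbounds(1) upper lower rest r \<open>a \<le> m\<close> \<open>b \<le> n\<close> by auto
qed

section \<open>Asymptotics in the smaller dimension and the almost sure statement\<close>

text \<open>With \<open>\<eta>\<close> half the gap between \<open>\<tau>\<close> and 1/2, the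
  exponent \<open>\<eta> - 1/2\<close> equals \<open>- \<tau> - \<eta>\<close>. The relative error
  is thus below the tolerance by a vanishing factor, which swallows the constant
  \<open>q\<close>.\<close>

lemma eventually_powr_scale:
  fixes \<tau> \<delta> q :: real
  assumes \<tau>: "0 < \<tau>" "\<tau> < 1/2" and q: "q > 0" and \<delta>: "\<delta> > 0"
  defines "\<eta> \<equiv> (1/2 - \<tau>) / 2"
  shows "eventually (\<lambda>\<mu>::nat. real \<mu> powr (\<eta> - 1/2) \<le> q * real \<mu> powr - \<tau> \<and>
    real \<mu> powr (\<eta> - 1/2) \<le> 1 \<and> real \<mu> powr - \<tau> \<le> \<delta>) sequentially"
proof -
  have small: "eventually (\<lambda>\<mu>::nat. real \<mu> powr - s < e) sequentially" if "s > 0" "e > 0" for s e :: real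
    by (rule order_tendstoD(2)[OF tendsto_neg_powr[OF _ filterlim_real_sequentially] that(2)]) (use that in auto)
  have \<eta>: "0 < \<eta>" "\<eta> < 1/2" "- \<tau> + - \<eta> = \<eta> - 1/2" using \<tau> by (simp_all add: \<eta>_def field_simps)
  have "eventually (\<lambda>\<mu>::nat. real \<mu> powr - (1/2 - \<eta>) < 1) sequentially"
    by (rule small) (use \<eta>(2) in simp_all)
  with small[OF \<eta>(1) q] small[OF \<tau>(1) \<delta>]
  show ?thesis
  proof eventually_elim
    case (elim \<mu>)
    have "real \<mu> powr (\<eta> - 1/2) = real \<mu> powr - \<tau> * real \<mu> powr - \<eta>"
      unfolding \<eta>(3)[symmetric] by (rule powr_add)
    also have "\<dots> \<le> real \<mu> powr - \<tau> * q" using elim(1) by (intro mult_left_mono) auto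
    finally show ?case using elim by (simp add: mult.commute)
  qed
qed

text \<open>Once \<open>n\<close> reaches the constant \<open>C0\<close>, one additional power of
  \<open>n\<close> absorbs it.\<close>

lemma polynomial_growth_bound:
  assumes "real m \<le> C0 * real n powr C" "C0 \<le> real n" "1 \<le> n" "C + 1 \<le> real H"
  shows "m \<le> n ^ H"
proof -
  have "real m \<le> C0 * real n powr C" by fact
  also have "\<dots> \<le> real n powr 1 * real n powr C" using assms by (intro mult_right_mono) auto
  also have "\<dots> = real n powr (C + 1)" by (simp add: powr_add)
  also have "\<dots> \<le> real n powr real H" using assms by (intro powr_mono) auto
  also have "\<dots> = real (n ^ H)" using assms by (simp add: powr_realpow)
  finally show ?thesis by simp
qed

lemma max_powr_neg:
  assumes "m > 0" "n > 0" "\<tau> > 0"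
  shows "max (real n powr - \<tau>) (real m powr - \<tau>) = real (min m n) powr - \<tau>"
  using assms powr_mono2'[of "- \<tau>" "real m" "real n"] powr_mono2'[of "- \<tau>" "real n" "real m"]
  by (auto simp: min_def max_def)

text \<open>The block sizes are quantified inside the almost sure event: the exceptional set comes
  from the noise alone, so one null set serves all divisions into blocks.\<close>

theorem theorem14:
  fixes P :: "real mat" and a b r :: nat
    and M :: "'w measure" and W :: "nat \<Rightarrow> nat \<Rightarrow> 'w \<Rightarrow> real mat"
    and K c d C C0 D D0 :: real
  assumes "P \<in> carrier_mat a b"
    and "vec_space.rank a P = r"
    and "\<And>i j. i < a \<Longrightarrow> j < b \<Longrightarrow> 0 \<le> P $$ (i, j)"
    and "\<And>i. i < a \<Longrightarrow> \<exists>j<b. P $$ (i, j) \<noteq> 0"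
    and "\<And>j. j < b \<Longrightarrow> \<exists>i<a. P $$ (i, j) \<noteq> 0"
    and "prob_space M"
    and "K > 0"
    and "\<And>m n. wigner_noise M K m n (W m n)"
    and "0 < c" "c < 1" "0 < d" "d < 1"
    and "C \<ge> 1" "D \<ge> 1" "C0 > 0" "D0 > 0"
  shows "\<exists>\<delta>>0. \<forall>\<tau>. 0 < \<tau> \<and> \<tau> < 1/2 \<longrightarrow>
    (AE \<omega> in M. \<exists>m0 n0. \<forall>m\<ge>m0. \<forall>n\<ge>n0. \<forall>ms ns.
       block_sizes a m ms \<and> block_sizes b n ns \<and> GC1 c d ms ns \<and> GC2 C C0 D D0 m n \<longrightarrow>
       (let A = blown_up P ms ns + W m n \<omega>;
            \<sigma> = singular_values (corr A);
            \<epsilon> = max (real n powr - \<tau>) (real m powr - \<tau>)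
        in (\<forall>i<m. 0 < row_sum A i) \<and> (\<forall>j<n. 0 < col_sum A j) \<and>
           (\<forall>k<r. \<sigma> ! k \<in> {\<delta> - \<epsilon> .. 1 + \<epsilon>}) \<and>
           (\<forall>k. r \<le> k \<and> k < min m n \<longrightarrow> \<sigma> ! k \<le> \<epsilon>)))"
proof -
  interpret prob_space M by fact
  obtain f g \<kappa> where r: "r \<le> a" "r \<le> b" and \<kappa>: "\<kappa> > 0"
    and f: "\<forall>k<r. f k < b" "inj_on f {..<r}"
    and fg: "\<forall>i<a. \<forall>j<b. P $$ (i, j) = (\<Sum>k<r. P $$ (i, f k) * g k j)"
    and \<kappa>_le: "\<forall>y. \<kappa> * (\<Sum>k<r. (y k)\<^sup>2) \<le> (\<Sum>i<a. (\<Sum>k<r. P $$ (i, f k) * y k)\<^sup>2)"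
    using rank_factorization[OF assms(1,2)] by blast
  define F where "F = {x \<in> (\<lambda>(i, j). P $$ (i, j)) ` ({..<a} \<times> {..<b}). x \<noteq> 0}"
  have finF: "finite F" by (simp add: F_def)
  have F_pos: "x > 0" if "x \<in> F" for x using that assms(3) by (force simp: F_def order_less_le)
  \<comment> \<open>The inserted 1 and 0 keep both extrema defined when \<open>F\<close> is empty;
    \<open>p0\<close> bounds the nonzero entries from below and \<open>p1\<close> all entries from
    above.\<close>
  define p0 where "p0 = Min (insert 1 F)"
  define p1 where "p1 = Max (insert 0 F)"
  have p0: "p0 > 0" using F_pos finF by (simp add: p0_def)
  have in_F: "P $$ (i, j) \<in> F" if "i < a" "j < b" "P $$ (i, j) \<noteq> 0" for i j
    using that by (auto simp: F_def intro!: image_eqI[of _ _ "(i, j)"])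
  have p0_le: "p0 \<le> P $$ (i, j)" if "i < a" "j < b" "P $$ (i, j) \<noteq> 0" for i j
    using finF in_F[OF that] by (simp add: p0_def)
  have p1_nonneg: "p1 \<ge> 0" using finF by (simp add: p1_def)
  have p1_ge: "P $$ (i, j) \<le> p1" if "i < a" "j < b" for i j
    using finF in_F[OF that] p1_nonneg by (cases "P $$ (i, j) = 0") (auto simp: p1_def)
  have p0_row: "\<exists>j<b. p0 \<le> P $$ (i, j)" if "i < a" for i using assms(4)[OF that] p0_le that by blast
  have p0_col: "\<exists>i<a. p0 \<le> P $$ (i, j)" if "j < b" for j using assms(5)[OF that] p0_le that by blast
  define \<delta> where "\<delta> = sqrt (c * d * \<kappa>) / (p1 + 1)"
  have \<delta>: "\<delta> > 0" using \<kappa> assms(9,11) p1_nonneg by (simp add: \<delta>_def)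
  \<comment> \<open>\<open>H\<close> exceeds both exponents of GC2 by at least 1, which is the room
    needed for the constants \<open>C0\<close> and \<open>D0\<close>.\<close>
  obtain H :: nat where "max C D + 1 \<le> real H" using real_arch_simple by blast
  hence H: "C + 1 \<le> real H" "D + 1 \<le> real H" "1 \<le> H" using assms(13) by linarith+
  show ?thesis
  proof (intro exI[of _ \<delta>] conjI allI impI)
    fix \<tau> :: real assume "0 < \<tau> \<and> \<tau> < 1/2"
    hence \<tau>: "0 < \<tau>" "\<tau> < 1/2" by auto
    define \<eta> where "\<eta> = (1/2 - \<tau>) / 2"
    have \<eta>: "\<eta> > 0" using \<tau> by (simp add: \<eta>_def)
    \<comment> \<open>With this \<open>q\<close>, the inequality
      \<open>\<gamma> \<le> q * \<epsilon>\<close> is exactly the smallness condition of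
      \<open>corr_singular_values\<close>.\<close>
    define q where "q = p0 * min c d / (8 * (1 + K))"
    have q: "q > 0" using p0 assms(7,9,11) by (simp add: q_def)
    obtain N where N: "\<And>\<mu>::nat. \<mu> \<ge> N \<Longrightarrow> real \<mu> powr (\<eta> - 1/2) \<le> q * real \<mu> powr - \<tau> \<and>
        real \<mu> powr (\<eta> - 1/2) \<le> 1 \<and> real \<mu> powr - \<tau> \<le> \<delta>"
      using eventually_powr_scale[OF \<tau> q \<delta>] unfolding \<eta>_def[symmetric] eventually_sequentially by blast
    obtain N' :: nat where N': "max C0 D0 \<le> real N'" using real_arch_simple by blast
    from wigner_noise_eventually_small[OF assms(8,7) \<eta>, of H]
    show "AE \<omega> in M. \<exists>m0 n0. \<forall>m\<ge>m0. \<forall>n\<ge>n0. \<forall>ms ns.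
       block_sizes a m ms \<and> block_sizes b n ns \<and> GC1 c d ms ns \<and> GC2 C C0 D D0 m n \<longrightarrow>
       (let A = blown_up P ms ns + W m n \<omega>;
            \<sigma> = singular_values (corr A);
            \<epsilon> = max (real n powr - \<tau>) (real m powr - \<tau>)
        in (\<forall>i<m. 0 < row_sum A i) \<and> (\<forall>j<n. 0 < col_sum A j) \<and>
           (\<forall>k<r. \<sigma> ! k \<in> {\<delta> - \<epsilon> .. 1 + \<epsilon>}) \<and>
           (\<forall>k. r \<le> k \<and> k < min m n \<longrightarrow> \<sigma> ! k \<le> \<epsilon>))"
      using AE_space
    proof eventually_elim
      case (elim \<omega>)
      from elim(1) obtain N0 where N0: "\<forall>\<mu>\<ge>N0. \<forall>m n. 1 \<le> m \<and> m \<le> \<mu> ^ H \<and> 1 \<le> n \<and> n \<le> \<mu> ^ H \<longrightarrow>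
         (\<forall>i<m. \<bar>\<Sum>j<n. W m n \<omega> $$ (i, j)\<bar> < sqrt (real n) * real \<mu> powr \<eta>) \<and>
         (\<forall>j<n. \<bar>\<Sum>i<m. W m n \<omega> $$ (i, j)\<bar> < sqrt (real m) * real \<mu> powr \<eta>) \<and>
         (\<forall>x y. (\<Sum>i<m. \<Sum>j<n. W m n \<omega> $$ (i, j) * (y i * x j))
            \<le> (sqrt (real (m + n)) * real \<mu> powr \<eta> + 2 * K) * sqrt (\<Sum>i<m. (y i)\<^sup>2) * sqrt (\<Sum>j<n. (x j)\<^sup>2))"
        by (rule exE)
      define N1 where "N1 = Max {N, N', N0, 1}"
      have N1: "N \<le> N1" "N' \<le> N1" "N0 \<le> N1" "1 \<le> N1" by (simp_all add: N1_def)
      show ?case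
      \<comment> \<open>One threshold for both dimensions makes \<open>\<mu> = min m n\<close> at
        least \<open>N1\<close>.\<close>
      proof (rule exI[of _ N1], rule exI[of _ N1], intro allI impI, elim conjE)
        fix m n ms ns
        assume mn: "N1 \<le> m" "N1 \<le> n" and bs: "block_sizes a m ms" "block_sizes b n ns"
          and gc: "GC1 c d ms ns" "GC2 C C0 D D0 m n"
        define \<mu> where "\<mu> = min m n"
        have \<mu>: "N1 \<le> \<mu>" "\<mu> \<le> m" "\<mu> \<le> n" "1 \<le> \<mu>" using mn N1 by (auto simp: \<mu>_def)
        have "C0 \<le> real \<mu>" "D0 \<le> real \<mu>" using N' N1(2) \<mu>(1) by auto
        hence "m \<le> n ^ H" "n \<le> m ^ H"
          using gc(2) \<mu> H unfolding GC2_def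
          by (auto intro!: polynomial_growth_bound[of m C0 n C] polynomial_growth_bound[of n D0 m D])
        moreover have "m \<le> m ^ H" "n \<le> n ^ H" using H(3) \<mu> by (auto intro: self_le_power)
        ultimately have "m \<le> \<mu> ^ H" "n \<le> \<mu> ^ H" unfolding \<mu>_def by (auto simp: min_def)
        hence noise: "(\<forall>i<m. \<bar>\<Sum>j<n. W m n \<omega> $$ (i, j)\<bar> < sqrt (real n) * real \<mu> powr \<eta>) \<and>
         (\<forall>j<n. \<bar>\<Sum>i<m. W m n \<omega> $$ (i, j)\<bar> < sqrt (real m) * real \<mu> powr \<eta>) \<and>
         (\<forall>x y. (\<Sum>i<m. \<Sum>j<n. W m n \<omega> $$ (i, j) * (y i * x j))
            \<le> (sqrt (real (m + n)) * real \<mu> powr \<eta> + 2 * K) * sqrt (\<Sum>i<m. (y i)\<^sup>2) * sqrt (\<Sum>j<n. (x j)\<^sup>2))"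
          by (intro N0[THEN spec, THEN mp, THEN spec, THEN spec, THEN mp]) (use \<mu> N1 in auto)
        have Wc: "W m n \<omega> \<in> carrier_mat m n" using assms(8)[of m n] elim(2) unfolding wigner_noise_def by blast
        define \<epsilon> where "\<epsilon> = real \<mu> powr - \<tau>"
        define \<gamma> where "\<gamma> = real \<mu> powr (\<eta> - 1/2)"
        have \<gamma>: "\<gamma> \<le> q * \<epsilon>" "\<gamma> \<le> 1" and \<epsilon>\<delta>: "\<epsilon> \<le> \<delta>"
          using N[of \<mu>] \<mu>(1) N1(1) unfolding \<gamma>_def \<epsilon>_def by auto
        \<comment> \<open>Written as \<open>\<gamma> * sqrt \<mu>\<close>, the noise level is at
          most \<open>\<gamma> * sqrt m\<close> and \<open>\<gamma> * sqrt n\<close> at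
          once.\<close>
        have "real \<mu> powr \<eta> = real \<mu> powr (\<eta> - 1/2) * real \<mu> powr (1/2)" by (simp add: powr_add[symmetric])
        hence \<theta>: "real \<mu> powr \<eta> = \<gamma> * sqrt (real \<mu>)" using \<mu> by (simp add: \<gamma>_def powr_half_sqrt)
        have \<epsilon>_eq: "max (real n powr - \<tau>) (real m powr - \<tau>) = \<epsilon>"
          unfolding \<epsilon>_def \<mu>_def using \<mu> \<tau> by (intro max_powr_neg) auto
        have "8 * (1 + K) * \<gamma> \<le> 8 * (1 + K) * (q * \<epsilon>)" using \<gamma>(1) assms(7) by (intro mult_left_mono) auto
        also have "\<dots> = p0 * min c d * \<epsilon>" using assms(7) by (simp add: q_def)
        finally have \<gamma>_le: "8 * (1 + K) * \<gamma> \<le> p0 * min c d * \<epsilon>" .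
        show "let A = blown_up P ms ns + W m n \<omega>;
            \<sigma> = singular_values (corr A);
            \<epsilon> = max (real n powr - \<tau>) (real m powr - \<tau>)
        in (\<forall>i<m. 0 < row_sum A i) \<and> (\<forall>j<n. 0 < col_sum A j) \<and>
           (\<forall>k<r. \<sigma> ! k \<in> {\<delta> - \<epsilon> .. 1 + \<epsilon>}) \<and>
           (\<forall>k. r \<le> k \<and> k < min m n \<longrightarrow> \<sigma> ! k \<le> \<epsilon>)"
          unfolding Let_def \<epsilon>_eq
        proof (rule corr_singular_values[OF assms(1) assms(3) p1_ge p1_nonneg p0 p0_row p0_col r _ f(2) _ \<kappa> _ bs gc(1)
              assms(9,11) _ _ Wc _ _ _ assms(7) _ _ _ \<gamma>_le \<gamma>(2) _ _ \<epsilon>\<delta> \<delta>_def])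
          show "f k < b" if "k < r" for k using f(1) that by blast
          show "P $$ (i, j) = (\<Sum>k<r. P $$ (i, f k) * g k j)" if "i < a" "j < b" for i j
            using fg that by blast
          show "\<kappa> * (\<Sum>k<r. (y k)\<^sup>2) \<le> (\<Sum>i<a. (\<Sum>k<r. P $$ (i, f k) * y k)\<^sup>2)" for y using \<kappa>_le by blast
          show "0 < m" "0 < n" using \<mu> by auto
          show "\<bar>\<Sum>j<n. W m n \<omega> $$ (i, j)\<bar> < sqrt (real n) * real \<mu> powr \<eta>" if "i < m" for i
            using noise that by blast
          show "\<bar>\<Sum>i<m. W m n \<omega> $$ (i, j)\<bar> < sqrt (real m) * real \<mu> powr \<eta>" if "j < n" for j
            using noise that by blast
          show "(\<Sum>i<m. \<Sum>j<n. W m n \<omega> $$ (i, j) * (y i * x j))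
            \<le> (sqrt (real (m + n)) * real \<mu> powr \<eta> + 2 * K) * sqrt (\<Sum>i<m. (y i)\<^sup>2) * sqrt (\<Sum>j<n. (x j)\<^sup>2)" for x y
            using noise by blast
          show "1 \<le> real \<mu> powr \<eta>" using \<mu>(4) \<eta> by (intro ge_one_powr_ge_zero) auto
          show "real \<mu> powr \<eta> \<le> \<gamma> * sqrt (real m)" "real \<mu> powr \<eta> \<le> \<gamma> * sqrt (real n)"
            unfolding \<theta> using \<mu> by (auto simp: \<gamma>_def intro!: mult_left_mono)
          show "0 < \<epsilon>" using \<mu>(4) by (simp add: \<epsilon>_def)
          show "\<epsilon> \<le> 1" unfolding \<epsilon>_def using \<mu>(4) \<tau> powr_mono[of "- \<tau>" 0 "real \<mu>"] by simp
        qed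
      qed
    qed
  qed (fact \<delta>)
qed

end
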